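(* Let $1<m\le n$. There exists a measure $\mu\in\mathcal{W}_1(\mathbb{R}^n,\mathbb{R}^m)$, absolutely continuous with respect to the Lebesgue measure, for which there is no optimal transport $\pi$ such that $\mathrm{P}_1\|\pi\|\ll\|\mu\|$. Moreover, there exists a transport set associated with the optimal potential of $\mu$ with non-zero measure $\mu$.
   Context: All norms are Euclidean. For an $\mathbb{R}^m$-valued Borel measure $\mu$, $\|\mu\|$ denotes its total variation. $\mathcal{W}_1(\mathbb{R}^n,\mathbb{R}^m)$ is the space of $\mathbb{R}^m$-valued Borel measures $\mu$ on $\mathbb{R}^n$ with $\mu(\mathbb{R}^n)=0$ and $\int\|x-x_0\|\,d\|\mu\|(x)<\infty$ for some $x_0$. For a measure $\pi$ on $\mathbb{R}^n\times\mathbb{R}^n$, $\mathrm{P}_1\pi(A)=\pi(A\times\mathbb{R}^n)$ and $\mathrm{P}_2\pi(A)=\pi(\mathbb{R}^n\times A)$. $\Gamma(\mu)$ is the set of $\mathbb{R}^m$-valued Borel measures $\pi$ on $\mathbb{R}^n\times\mathbb{R}^n$ with $\mathrm{P}_1\pi-\mathrm{P}_2\pi=\mu$. An optimal transport of $\mu$ is $\pi\in\Gamma(\mu)$ attaining $\inf\{\int\|x-y\|\,d\|\pi\|(x,y)\mid\pi\in\Gamma(\mu)\}$. An optimal potential of $\mu$ is a $1$-Lipschitz map $u\colon\mathbb{R}^n\to\mathbb{R}^m$ attaining $\sup\{\int\langle v,d\mu\rangle\mid v\colon\mathbb{R}^n\to\mathbb{R}^m\ 1\text{-Lipschitz}\}$.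 A leaf of a $1$-Lipschitz map $u$ is a maximal (with respect to inclusion) set $\mathcal{S}\subset\mathbb{R}^n$ such that $u|_{\mathcal{S}}$ preserves distances. $B(u)$ is the set of points belonging to at least two distinct leaves of $u$. A transport set associated with $u$ is a Borel set $A\subset\mathbb{R}^n$ such that if $x\in A\setminus B(u)$ and $y\in\mathbb{R}^n$ satisfy $\|u(x)-u(y)\|=\|x-y\|$, then $y\in A$. *)

theory Defs
  imports "HOL-Analysis.Analysis"
begin

text \<open>A vector-valued Borel measure is a set function whose values outside the Borel sets are
  irrelevant. Countable additivity on the constant sequence of empty sets forces
  \<^term>\<open>\<mu> {} = 0\<close>.\<close>

definition vector_measure ::
    "('a::topological_space set \<Rightarrow> 'b::real_normed_vector) \<Rightarrow> bool" where
  "vector_measure \<mu> \<longleftrightarrow>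
     (\<forall>A::nat \<Rightarrow> 'a set. range A \<subseteq> sets borel \<longrightarrow> disjoint_family A \<longrightarrow>
        (\<lambda>i. \<mu> (A i)) sums \<mu> (\<Union>i. A i))"

definition variation ::
    "('a::topological_space set \<Rightarrow> 'b::real_normed_vector) \<Rightarrow> 'a set \<Rightarrow> ennreal" where
  "variation \<mu> A =
     (SUP P \<in> {P. finite P \<and> P \<subseteq> sets borel \<and> partition_on A P}. \<Sum>D\<in>P. ennreal (norm (\<mu> D)))"

definition total_variation ::
    "('a::topological_space set \<Rightarrow> 'b::real_normed_vector) \<Rightarrow> 'a measure" where
  "total_variation \<mu> = measure_of UNIV (sets borel) (variation \<mu>)"

text \<open>Positive part of the Jordan decomposition of a real-valued measure; the function
  \<^const>\<open>ennreal\<close> truncates negative values to 0, which does not affect the supremum since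
  the empty set is among the competitors.\<close>

definition upper_variation :: "('a::topological_space set \<Rightarrow> real) \<Rightarrow> 'a set \<Rightarrow> ennreal" where
  "upper_variation \<nu> A = (SUP B \<in> {B \<in> sets borel. B \<subseteq> A}. ennreal (\<nu> B))"

definition positive_part :: "('a::topological_space set \<Rightarrow> real) \<Rightarrow> 'a measure" where
  "positive_part \<nu> = measure_of UNIV (sets borel) (upper_variation \<nu>)"

definition signed_integral :: "('a::topological_space set \<Rightarrow> real) \<Rightarrow> ('a \<Rightarrow> real) \<Rightarrow> real" where
  "signed_integral \<nu> f =
     integral\<^sup>L (positive_part \<nu>) f - integral\<^sup>L (positive_part (\<lambda>A. - \<nu> A)) f"

text \<open>The integral of the scalar product of \<^term>\<open>v\<close> against \<^term>\<open>\<mu>\<close>, computed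
  componentwise in the orthonormal basis.\<close>

definition vector_integral ::
    "('a::topological_space set \<Rightarrow> 'b::euclidean_space) \<Rightarrow> ('a \<Rightarrow> 'b) \<Rightarrow> real" where
  "vector_integral \<mu> v = (\<Sum>b\<in>Basis. signed_integral (\<lambda>A. \<mu> A \<bullet> b) (\<lambda>x. v x \<bullet> b))"

definition W1 :: "('a::euclidean_space set \<Rightarrow> 'b::euclidean_space) set" where
  "W1 = {\<mu>. vector_measure \<mu> \<and> \<mu> UNIV = 0 \<and>
     (\<exists>x0. (\<integral>\<^sup>+x. ennreal (norm (x - x0)) \<partial>total_variation \<mu>) < \<infinity>)}"

definition vector_absolutely_continuous ::
    "'a::topological_space measure \<Rightarrow> ('a set \<Rightarrow> 'b::real_normed_vector) \<Rightarrow> bool" where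
  "vector_absolutely_continuous M \<mu> \<longleftrightarrow> (\<forall>A\<in>null_sets M. \<mu> A = 0)"

definition couplings ::
    "('a::euclidean_space set \<Rightarrow> 'b::euclidean_space) \<Rightarrow> (('a \<times> 'a) set \<Rightarrow> 'b) set" where
  "couplings \<mu> = {\<pi>. vector_measure \<pi> \<and>
     (\<forall>A\<in>sets borel. \<pi> (A \<times> UNIV) - \<pi> (UNIV \<times> A) = \<mu> A)}"

definition transport_cost ::
    "(('a::euclidean_space \<times> 'a) set \<Rightarrow> 'b::euclidean_space) \<Rightarrow> ennreal" where
  "transport_cost \<pi> = (\<integral>\<^sup>+(x, y). ennreal (norm (x - y)) \<partial>total_variation \<pi>)"

definition optimal_transport ::
    "('a::euclidean_space set \<Rightarrow> 'b::euclidean_space) \<Rightarrow> (('a \<times> 'a) set \<Rightarrow> 'b) \<Rightarrow> bool" where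
  "optimal_transport \<mu> \<pi> \<longleftrightarrow>
     \<pi> \<in> couplings \<mu> \<and> transport_cost \<pi> = (INF \<pi>' \<in> couplings \<mu>. transport_cost \<pi>')"

definition optimal_potential ::
    "('a::euclidean_space set \<Rightarrow> 'b::euclidean_space) \<Rightarrow> ('a \<Rightarrow> 'b) \<Rightarrow> bool" where
  "optimal_potential \<mu> u \<longleftrightarrow> 1-lipschitz_on UNIV u \<and>
     (\<forall>v. 1-lipschitz_on UNIV v \<longrightarrow> vector_integral \<mu> v \<le> vector_integral \<mu> u)"

definition preserves_distances_on ::
    "'a::metric_space set \<Rightarrow> ('a \<Rightarrow> 'b::metric_space) \<Rightarrow> bool" where
  "preserves_distances_on S u \<longleftrightarrow> (\<forall>x\<in>S. \<forall>y\<in>S. dist (u x) (u y) = dist x y)"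

definition leaf :: "('a::metric_space \<Rightarrow> 'b::metric_space) \<Rightarrow> 'a set \<Rightarrow> bool" where
  "leaf u S \<longleftrightarrow> preserves_distances_on S u \<and>
     (\<forall>T. S \<subseteq> T \<longrightarrow> preserves_distances_on T u \<longrightarrow> T = S)"

definition branching_set :: "('a::metric_space \<Rightarrow> 'b::metric_space) \<Rightarrow> 'a set" where
  "branching_set u = {x. \<exists>S T. leaf u S \<and> leaf u T \<and> S \<noteq> T \<and> x \<in> S \<and> x \<in> T}"

definition transport_set :: "('a::metric_space \<Rightarrow> 'b::metric_space) \<Rightarrow> 'a set \<Rightarrow> bool" where
  "transport_set u A \<longleftrightarrow> A \<in> sets borel \<and>
     (\<forall>x \<in> A - branching_set u. \<forall>y. dist (u x) (u y) = dist x y \<longrightarrow> y \<in> A)"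


text \<open>The constant \<^const>\<open>measure_of\<close> yields the zero measure when its set function is not
  countably additive; the lemmas below show that this does not happen here.\<close>

lemma vector_measure_sums:
  assumes "vector_measure \<mu>" "range A \<subseteq> sets borel" "disjoint_family A"
  shows "(\<lambda>i::nat. \<mu> (A i)) sums \<mu> (\<Union>i. A i)"
  using assms unfolding vector_measure_def by blast

lemma vector_measure_empty:
  assumes "vector_measure \<mu>"
  shows "\<mu> {} = 0"
proof -
  have "(\<lambda>i::nat. \<mu> {}) sums \<mu> {}"
    using vector_measure_sums[OF assms, of "\<lambda>_. {}"] by (simp add: disjoint_family_on_def)
  then have "(\<lambda>i::nat. \<mu> {}) \<longlonglongrightarrow> 0"
    using sums_summable summable_LIMSEQ_zero by blast
  then show ?thesis
    by (simp add: LIMSEQ_const_iff)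
qed

lemma vector_measure_Int_sums:
  assumes "vector_measure \<mu>" "range A \<subseteq> sets borel" "disjoint_family A" "D \<in> sets borel"
    and "D \<subseteq> (\<Union>i. A i)"
  shows "(\<lambda>i::nat. \<mu> (D \<inter> A i)) sums \<mu> D"
proof -
  have "disjoint_family (\<lambda>i. D \<inter> A i)"
    using assms(3) by (auto simp: disjoint_family_on_def)
  moreover have "range (\<lambda>i. D \<inter> A i) \<subseteq> sets borel"
    using assms(2,4) by auto
  moreover have "(\<Union>i. D \<inter> A i) = D"
    using assms(5) by auto
  ultimately show ?thesis
    using vector_measure_sums[OF assms(1), of "\<lambda>i. D \<inter> A i"] by simp
qed

lemma ennreal_norm_le_suminf:
  assumes "f sums s"
  shows "ennreal (norm s) \<le> (\<Sum>i. ennreal (norm (f i)))"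
proof (rule LIMSEQ_le_const2)
  show "(\<lambda>n. ennreal (norm (\<Sum>i<n. f i))) \<longlonglongrightarrow> ennreal (norm s)"
    using assms unfolding sums_def by (intro tendsto_ennrealI tendsto_norm)
  have "ennreal (norm (\<Sum>i<n. f i)) \<le> (\<Sum>i. ennreal (norm (f i)))" for n
  proof -
    have "ennreal (norm (\<Sum>i<n. f i)) \<le> ennreal (\<Sum>i<n. norm (f i))"
      by (intro ennreal_leI norm_sum)
    also have "\<dots> = (\<Sum>i<n. ennreal (norm (f i)))"
      by simp
    also have "\<dots> \<le> (\<Sum>i. ennreal (norm (f i)))"
      by (intro sum_le_suminf) auto
    finally show ?thesis .
  qed
  then show "\<exists>N. \<forall>n\<ge>N. ennreal (norm (\<Sum>i<n. f i)) \<le> (\<Sum>i. ennreal (norm (f i)))"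
    by blast
qed

lemma ennreal_le_suminf:
  assumes "f sums (s::real)"
  shows "ennreal s \<le> (\<Sum>i. ennreal (f i))"
proof (rule LIMSEQ_le_const2)
  show "(\<lambda>n. ennreal (\<Sum>i<n. f i)) \<longlonglongrightarrow> ennreal s"
    using assms unfolding sums_def by (intro tendsto_ennrealI)
  have "ennreal (\<Sum>i<n. f i) \<le> (\<Sum>i. ennreal (f i))" for n
  proof -
    have "ennreal (\<Sum>i<n. f i) \<le> ennreal (\<Sum>i<n. max 0 (f i))"
      by (intro ennreal_leI sum_mono) auto
    also have "\<dots> = (\<Sum>i<n. ennreal (max 0 (f i)))"
      by (simp flip: sum_ennreal)
    also have "\<dots> = (\<Sum>i<n. ennreal (f i))"
      by (intro sum.cong refl) (auto simp: max_def ennreal_neg)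
    also have "\<dots> \<le> (\<Sum>i. ennreal (f i))"
      by (intro sum_le_suminf) auto
    finally show ?thesis .
  qed
  then show "\<exists>N. \<forall>n\<ge>N. ennreal (\<Sum>i<n. f i) \<le> (\<Sum>i. ennreal (f i))"
    by blast
qed

lemma ennreal_SUP_add_le:
  fixes f :: "'i \<Rightarrow> ennreal" and g :: "'j \<Rightarrow> ennreal"
  assumes "I \<noteq> {}" "J \<noteq> {}" "\<And>i j. i \<in> I \<Longrightarrow> j \<in> J \<Longrightarrow> f i + g j \<le> c"
  shows "(SUP i\<in>I. f i) + (SUP j\<in>J. g j) \<le> c"
proof -
  have "f i + (SUP j\<in>J. g j) \<le> c" if "i \<in> I" for i
    unfolding ennreal_SUP_add_right[OF assms(2)] using that by (intro SUP_least assms(3))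
  then show ?thesis
    unfolding ennreal_SUP_add_left[OF assms(1), symmetric] by (intro SUP_least)
qed

lemma countably_additive_borelI:
  fixes V :: "'a::topological_space set \<Rightarrow> ennreal"
  assumes empty: "V {} = 0"
    and super: "\<And>A B. A \<in> sets borel \<Longrightarrow> B \<in> sets borel \<Longrightarrow> A \<inter> B = {} \<Longrightarrow> V A + V B \<le> V (A \<union> B)"
    and sub: "\<And>A :: nat \<Rightarrow> 'a set. range A \<subseteq> sets borel \<Longrightarrow> disjoint_family A \<Longrightarrow>
       V (\<Union>i. A i) \<le> (\<Sum>i. V (A i))"
  shows "countably_additive (sets borel) V"
  unfolding countably_additive_def
proof (intro allI impI)
  fix A :: "nat \<Rightarrow> 'a set"
  assume A: "range A \<subseteq> sets borel" "disjoint_family A"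
  have fin: "(\<Sum>i<n. V (A i)) \<le> V (\<Union>i<n. A i)" for n
  proof (induction n)
    case (Suc n)
    have "(\<Sum>i<Suc n. V (A i)) \<le> V (\<Union>i<n. A i) + V (A n)"
      using Suc by (simp add: add_right_mono)
    also have "\<dots> \<le> V ((\<Union>i<n. A i) \<union> A n)"
    proof (intro super)
      show "(\<Union>i<n. A i) \<inter> A n = {}"
      proof -
        have "A i \<inter> A n = {}" if "i < n" for i
          using disjoint_family_onD[OF A(2), of i n] that by simp
        then show ?thesis
          by blast
      qed
    qed (use A(1) in auto)
    also have "(\<Union>i<n. A i) \<union> A n = (\<Union>i<Suc n. A i)"
      by (auto simp: less_Suc_eq)
    finally show ?case .
  qed (simp add: empty)
  have "(\<Sum>i. V (A i)) \<le> V (\<Union>i. A i)"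
  proof (intro suminf_le_const)
    fix n
    have "V (\<Union>i<n. A i) \<le> V (\<Union>i<n. A i) + V ((\<Union>i. A i) - (\<Union>i<n. A i))"
      by simp
    also have "\<dots> \<le> V ((\<Union>i<n. A i) \<union> ((\<Union>i. A i) - (\<Union>i<n. A i)))"
      using A(1) by (intro super sets.Diff sets.countable_UN sets.finite_UN) auto
    also have "(\<Union>i<n. A i) \<union> ((\<Union>i. A i) - (\<Union>i<n. A i)) = (\<Union>i. A i)"
      by auto
    finally show "(\<Sum>i<n. V (A i)) \<le> V (\<Union>i. A i)"
      using fin[of n] by (rule order_trans[rotated])
  qed auto
  then show "(\<Sum>i. V (A i)) = V (\<Union>i. A i)"
    using sub[OF A] by (rule antisym)
qed

lemma variation_upper:
  assumes "finite P" "P \<subseteq> sets borel" "partition_on A P"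
  shows "(\<Sum>D\<in>P. ennreal (norm (\<mu> D))) \<le> variation \<mu> A"
  unfolding variation_def using assms by (intro SUP_upper) auto

lemma borel_partition_exists:
  assumes "A \<in> sets borel"
  shows "{P. finite P \<and> P \<subseteq> sets borel \<and> partition_on A P} \<noteq> {}"
proof -
  have "partition_on A ({A} - {{}})"
    by (auto simp: partition_on_def disjoint_def)
  then show ?thesis
    using assms by (auto intro!: exI[of _ "{A} - {{}}"])
qed

lemma variation_superadditive:
  assumes "A \<in> sets borel" "B \<in> sets borel" "A \<inter> B = {}"
  shows "variation \<mu> A + variation \<mu> B \<le> variation \<mu> (A \<union> B)"
  unfolding variation_def[of \<mu> A] variation_def[of \<mu> B]
proof (rule ennreal_SUP_add_le)
  fix P Q
  assume "P \<in> {P. finite P \<and> P \<subseteq> sets borel \<and> partition_on A P}"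
    and "Q \<in> {P. finite P \<and> P \<subseteq> sets borel \<and> partition_on B P}"
  then have P: "finite P" "P \<subseteq> sets borel" "partition_on A P"
    and Q: "finite Q" "Q \<subseteq> sets borel" "partition_on B Q"
    by auto
  have "P \<inter> Q = {}"
  proof (rule equals0I)
    fix D assume D: "D \<in> P \<inter> Q"
    then have "D \<subseteq> A" "D \<subseteq> B" "D \<noteq> {}"
      using P(3) Q(3) by (auto simp: partition_on_def)
    then show False
      using assms(3) by blast
  qed
  then have "(\<Sum>D\<in>P. ennreal (norm (\<mu> D))) + (\<Sum>D\<in>Q. ennreal (norm (\<mu> D))) =
      (\<Sum>D\<in>P \<union> Q. ennreal (norm (\<mu> D)))"
    using P(1) Q(1) by (intro sum.union_disjoint[symmetric])
  also have "\<dots> \<le> variation \<mu> (A \<union> B)"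
  proof (rule variation_upper)
    show "partition_on (A \<union> B) (P \<union> Q)"
      using P(3) Q(3) assms(3) by (simp add: partition_on_def disjoint_union)
  qed (use P Q in auto)
  finally show "(\<Sum>D\<in>P. ennreal (norm (\<mu> D))) + (\<Sum>D\<in>Q. ennreal (norm (\<mu> D)))
      \<le> variation \<mu> (A \<union> B)" .
qed (use assms in \<open>simp_all only: borel_partition_exists not_False_eq_True simp_thms\<close>)

lemma sum_norm_Int_le_variation:
  assumes \<mu>: "vector_measure \<mu>" and P: "finite P" "P \<subseteq> sets borel" "partition_on U P"
    and A: "A \<in> sets borel" "A \<subseteq> U"
  shows "(\<Sum>D\<in>P. ennreal (norm (\<mu> (D \<inter> A)))) \<le> variation \<mu> A"
proof -
  have "(\<Sum>D\<in>P. ennreal (norm (\<mu> (D \<inter> A)))) = (\<Sum>D\<in>(\<lambda>D. D \<inter> A) ` P. ennreal (norm (\<mu> D)))"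
  proof (rule sum.reindex_nontrivial[OF P(1), symmetric, unfolded o_def])
    fix D E assume "D \<in> P" "E \<in> P" "D \<noteq> E" "D \<inter> A = E \<inter> A"
    then have "D \<inter> A = {}"
      using P(3) unfolding partition_on_def disjoint_def by blast
    then show "ennreal (norm (\<mu> (D \<inter> A))) = 0"
      by (simp add: vector_measure_empty[OF \<mu>])
  qed
  also have "\<dots> = (\<Sum>D\<in>(\<inter>) A ` P - {{}}. ennreal (norm (\<mu> D)))"
    using P(1) by (intro sum.mono_neutral_cong_right)
      (auto simp: vector_measure_empty[OF \<mu>] Int_commute)
  also have "\<dots> \<le> variation \<mu> A"
  proof (rule variation_upper)
    show "partition_on A ((\<inter>) A ` P - {{}})"
      using partition_on_restrict[OF P(3), of A] A(2) by (simp add: Int_absorb2)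
  qed (use P A in auto)
  finally show ?thesis .
qed

theorem emeasure_total_variation:
  assumes \<mu>: "vector_measure \<mu>" and "A \<in> sets borel"
  shows "emeasure (total_variation \<mu>) A = variation \<mu> A"
  unfolding total_variation_def
proof (rule emeasure_measure_of_sigma)
  show "sigma_algebra UNIV (sets (borel :: 'a measure))"
    using sets.sigma_algebra_axioms[of "borel :: 'a measure"] by simp
  have "{P. finite P \<and> P \<subseteq> sets borel \<and> partition_on {} P} = {{} :: 'a set set}"
    by (auto simp: partition_on_def)
  then have empty: "variation \<mu> {} = 0"
    by (simp add: variation_def)
  then show "positive (sets borel) (variation \<mu>)"
    by (simp add: positive_def)
  show "countably_additive (sets borel) (variation \<mu>)"
  proof (rule countably_additive_borelI[where V = "variation \<mu>", OF empty variation_superadditive])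
    fix A :: "nat \<Rightarrow> 'a set"
    assume A: "range A \<subseteq> sets borel" "disjoint_family A"
    show "variation \<mu> (\<Union>i. A i) \<le> (\<Sum>i. variation \<mu> (A i))"
      unfolding variation_def[of \<mu> "\<Union>i. A i"]
    proof (rule SUP_least)
      fix P assume "P \<in> {P. finite P \<and> P \<subseteq> sets borel \<and> partition_on (\<Union>i. A i) P}"
      then have P: "finite P" "P \<subseteq> sets borel" "partition_on (\<Union>i. A i) P"
        by auto
      have "(\<Sum>D\<in>P. ennreal (norm (\<mu> D))) \<le> (\<Sum>D\<in>P. \<Sum>i. ennreal (norm (\<mu> (D \<inter> A i))))"
        using P by (intro sum_mono ennreal_norm_le_suminf vector_measure_Int_sums[OF \<mu> A])
          (auto simp: partition_on_def)
      also have "\<dots> = (\<Sum>i. \<Sum>D\<in>P. ennreal (norm (\<mu> (D \<inter> A i))))"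
        by (rule suminf_sum[symmetric]) simp
      also have "\<dots> \<le> (\<Sum>i. variation \<mu> (A i))"
        using A by (intro suminf_le allI sum_norm_Int_le_variation[OF \<mu> P]) auto
      finally show "(\<Sum>D\<in>P. ennreal (norm (\<mu> D))) \<le> (\<Sum>i. variation \<mu> (A i))" .
    qed
  qed auto
qed fact

theorem emeasure_positive_part:
  assumes \<nu>: "vector_measure \<nu>" and "A \<in> sets borel"
  shows "emeasure (positive_part \<nu>) A = upper_variation \<nu> A"
  unfolding positive_part_def
proof (rule emeasure_measure_of_sigma)
  show "sigma_algebra UNIV (sets (borel :: 'a measure))"
    using sets.sigma_algebra_axioms[of "borel :: 'a measure"] by simp
  have "{B \<in> sets borel. B \<subseteq> {}} = {{} :: 'a set}"
    by auto
  then have empty: "upper_variation \<nu> {} = 0"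
    by (simp add: upper_variation_def vector_measure_empty[OF \<nu>])
  then show "positive (sets borel) (upper_variation \<nu>)"
    by (simp add: positive_def)
  show "countably_additive (sets borel) (upper_variation \<nu>)"
  proof (rule countably_additive_borelI[where V = "upper_variation \<nu>", OF empty])
    fix A B :: "'a set"
    assume AB: "A \<in> sets borel" "B \<in> sets borel" "A \<inter> B = {}"
    have "ennreal (\<nu> C) + ennreal (\<nu> D) \<le> upper_variation \<nu> (A \<union> B)"
      if C: "C \<in> sets borel" "C \<subseteq> A" and D: "D \<in> sets borel" "D \<subseteq> B" for C D
    proof -
      have up: "ennreal (\<nu> E) \<le> upper_variation \<nu> (A \<union> B)" if "E \<in> sets borel" "E \<subseteq> A \<union> B" for E
        unfolding upper_variation_def using that by (intro SUP_upper) auto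
      let ?F = "binaryset C D"
      have "range ?F \<subseteq> sets borel" "disjoint_family ?F"
        using C D AB(3) by (auto simp: binaryset_def disjoint_family_on_def)
      then have "(\<lambda>i. \<nu> (?F i)) sums \<nu> (C \<union> D)"
        using vector_measure_sums[OF \<nu>, of ?F] by (simp add: UN_binaryset_eq)
      moreover have "(\<lambda>i. \<nu> (?F i)) sums (\<nu> C + \<nu> D)"
        by (rule binaryset_sums) (rule vector_measure_empty[OF \<nu>])
      ultimately have eq: "\<nu> (C \<union> D) = \<nu> C + \<nu> D"
        by (rule sums_unique2)
      consider "\<nu> C \<le> 0" | "\<nu> D \<le> 0" | "0 \<le> \<nu> C" "0 \<le> \<nu> D"
        by linarith
      then show ?thesis
      proof cases
        case 1
        then show ?thesis using up[of D] D by (auto simp: ennreal_neg)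
      next
        case 2
        then show ?thesis using up[of C] C by (auto simp: ennreal_neg)
      next
        case 3
        then show ?thesis using up[of "C \<union> D"] C D by (auto simp: eq)
      qed
    qed
    then show "upper_variation \<nu> A + upper_variation \<nu> B \<le> upper_variation \<nu> (A \<union> B)"
      unfolding upper_variation_def[of \<nu> A] upper_variation_def[of \<nu> B]
      by (intro ennreal_SUP_add_le) auto
  next
    fix A :: "nat \<Rightarrow> 'a set"
    assume A: "range A \<subseteq> sets borel" "disjoint_family A"
    show "upper_variation \<nu> (\<Union>i. A i) \<le> (\<Sum>i. upper_variation \<nu> (A i))"
      unfolding upper_variation_def[of \<nu> "\<Union>i. A i"]
    proof (rule SUP_least)
      fix D assume D: "D \<in> {B \<in> sets borel. B \<subseteq> (\<Union>i. A i)}"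
      have "ennreal (\<nu> D) \<le> (\<Sum>i. ennreal (\<nu> (D \<inter> A i)))"
        using D by (intro ennreal_le_suminf vector_measure_Int_sums[OF \<nu> A]) auto
      also have "\<dots> \<le> (\<Sum>i. upper_variation \<nu> (A i))"
        unfolding upper_variation_def using A D by (intro suminf_le allI SUP_upper) auto
      finally show "ennreal (\<nu> D) \<le> (\<Sum>i. upper_variation \<nu> (A i))" .
    qed
  qed
qed fact

end

theory Submission
  imports Defs
begin

text \<open>
  Fix a direction \<open>e\<close>, an orthonormal pair \<open>a\<close>, \<open>b\<close>, and let \<open>g t = cos t a + sin t b\<close>. The map
  \<open>u x = g (x \<bullet> e + pi / 2)\<close> winds space around a circle: its derivative along \<open>e\<close> is the unit
  vector \<open>- g (x \<bullet> e)\<close>, although \<open>u\<close> strictly decreases the distance of any two distinct points. The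
  measure \<open>\<mu>\<close> has a density \<open>f\<close> supported in a box \<open>U\<close>, namely the derivative along \<open>e\<close> of
  \<open>H x = h x g (x \<bullet> e)\<close>, where \<open>h x = sin (x \<bullet> e)\<close> on \<open>U\<close>. Integrating by parts,
  \<open>\<integral> v \<bullet> f \<le> \<integral> h\<close> for every 1-Lipschitz \<open>v\<close>, with equality for \<open>u\<close>.

  Moving \<open>H x / \<epsilon>\<close> from \<open>x\<close> to \<open>x + \<epsilon> e\<close>, up to a correction which is small in \<open>L\<^sup>1\<close>,
  gives couplings of cost tending to \<open>\<integral> h\<close>. A coupling of cost at most \<open>\<integral> h\<close> would have to be
  concentrated on pairs whose distance is preserved by \<open>u\<close>, that is on the diagonal, and would have cost 0.
  Hence there is no optimal transport at all.

  Any optimal potential \<open>v\<close> has the same increments along \<open>e\<close> within \<open>U\<close> as \<open>u\<close>. If \<open>v\<close> is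
  isometric on a segment starting in \<open>U\<close>, it is affine there, and the curvature of the circle forces the segment
  to be orthogonal to \<open>e\<close>. The points joined in this way to a small ball of \<open>U\<close> form a transport set whose
  part in \<open>U\<close> lies in the slab \<open>x \<bullet> e < pi / 2\<close>, where \<open>f \<bullet> b > 0\<close>.
\<close>

section \<open>Total variation\<close>

text \<open>The left integral is a supremum over simple functions. Such a function is simple for
  every \<open>N i\<close> as well, and the hypothesis can be applied to each of its finitely many
  level sets.\<close>

lemma nn_integral_le_sum_measures:
  assumes I: "finite I" and sets: "\<And>i. i \<in> I \<Longrightarrow> sets (N i) = sets M"
    and le: "\<And>A. A \<in> sets M \<Longrightarrow> emeasure M A \<le> (\<Sum>i\<in>I. emeasure (N i) A)"
  shows "(\<integral>\<^sup>+x. f x \<partial>M) \<le> (\<Sum>i\<in>I. \<integral>\<^sup>+x. f x \<partial>N i)"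
  unfolding nn_integral_def[of M f]
proof (rule SUP_least)
  fix s assume "s \<in> {g. simple_function M g \<and> g \<le> f}"
  then have s: "simple_function M s" "s \<le> f" by auto
  have sp: "space (N i) = space M" if "i \<in> I" for i
    using sets_eq_imp_space_eq[OF sets[OF that]] .
  have sN: "simple_function (N i) s" if "i \<in> I" for i
    using s(1) unfolding simple_function_def sp[OF that] sets[OF that] .
  have meas: "s -` {c} \<inter> space M \<in> sets M" for c
    using s(1) by (rule simple_functionD)
  have "integral\<^sup>S M s = (\<Sum>c\<in>s ` space M. c * emeasure M (s -` {c} \<inter> space M))"
    by (simp add: simple_integral_def)
  also have "\<dots> \<le> (\<Sum>c\<in>s ` space M. c * (\<Sum>i\<in>I. emeasure (N i) (s -` {c} \<inter> space M)))"
    by (intro sum_mono mult_left_mono le meas) auto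
  also have "\<dots> = (\<Sum>i\<in>I. integral\<^sup>S (N i) s)"
    unfolding sum_distrib_left simple_integral_def
    by (subst sum.swap) (intro sum.cong refl, simp_all add: sp)
  also have "\<dots> = (\<Sum>i\<in>I. \<integral>\<^sup>+x. s x \<partial>N i)"
    by (intro sum.cong refl) (simp add: nn_integral_eq_simple_integral sN)
  also have "\<dots> \<le> (\<Sum>i\<in>I. \<integral>\<^sup>+x. f x \<partial>N i)"
    using s(2) by (intro sum_mono nn_integral_mono) (auto simp: le_fun_def)
  finally show "integral\<^sup>S M s \<le> (\<Sum>i\<in>I. \<integral>\<^sup>+x. f x \<partial>N i)" .
qed

lemma sets_total_variation [measurable_cong, simp]: "sets (total_variation \<mu>) = sets borel"
  unfolding total_variation_def
  using sets.sigma_algebra_axioms[of "borel :: 'a measure"]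
  by (subst sets_measure_of) (auto simp: sigma_algebra.sigma_sets_eq)

lemma space_total_variation [simp]: "space (total_variation \<mu>) = UNIV"
  using sets_eq_imp_space_eq[OF sets_total_variation] by simp

lemma sets_positive_part [measurable_cong, simp]: "sets (positive_part \<mu>) = sets borel"
  unfolding positive_part_def
  using sets.sigma_algebra_axioms[of "borel :: 'a measure"]
  by (subst sets_measure_of) (auto simp: sigma_algebra.sigma_sets_eq)

text \<open>Total variation is the least measure dominating the norm: summing the bound over the
  cells of a finite partition of \<open>A\<close> reproduces its right-hand side at
  \<open>A\<close>, because each \<open>N i\<close> is additive.\<close>

lemma nn_integral_total_variation_le:
  assumes \<mu>: "vector_measure \<mu>" and I: "finite I" and sets: "\<And>i. i \<in> I \<Longrightarrow> sets (N i) = sets borel"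
    and le: "\<And>A. A \<in> sets borel \<Longrightarrow> ennreal (norm (\<mu> A)) \<le> (\<Sum>i\<in>I. emeasure (N i) A)"
  shows "(\<integral>\<^sup>+x. f x \<partial>total_variation \<mu>) \<le> (\<Sum>i\<in>I. \<integral>\<^sup>+x. f x \<partial>N i)"
proof (rule nn_integral_le_sum_measures[OF I])
  fix A assume "A \<in> sets (total_variation \<mu>)"
  then have A: "A \<in> sets borel" by simp
  have "variation \<mu> A \<le> (\<Sum>i\<in>I. emeasure (N i) A)"
    unfolding variation_def
  proof (rule SUP_least)
    fix P assume "P \<in> {P. finite P \<and> P \<subseteq> sets borel \<and> partition_on A P}"
    then have P: "finite P" "P \<subseteq> sets borel" "partition_on A P" by auto
    have "(\<Sum>D\<in>P. ennreal (norm (\<mu> D))) \<le> (\<Sum>D\<in>P. \<Sum>i\<in>I. emeasure (N i) D)"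
      using P by (intro sum_mono le) auto
    also have "\<dots> = (\<Sum>i\<in>I. \<Sum>D\<in>P. emeasure (N i) D)"
      by (rule sum.swap)
    also have "\<dots> = (\<Sum>i\<in>I. emeasure (N i) A)"
    proof (intro sum.cong refl)
      fix i assume "i \<in> I"
      then show "(\<Sum>D\<in>P. emeasure (N i) D) = emeasure (N i) A"
        using sum_emeasure[of "\<lambda>D. D" P "N i"] P sets[of i]
        by (auto simp: disjoint_family_on_disjoint_image partition_on_def disjoint_def disjoint_family_on_def)
    qed
    finally show "(\<Sum>D\<in>P. ennreal (norm (\<mu> D))) \<le> (\<Sum>i\<in>I. emeasure (N i) A)" .
  qed
  then show "emeasure (total_variation \<mu>) A \<le> (\<Sum>i\<in>I. emeasure (N i) A)"
    by (simp add: emeasure_total_variation[OF \<mu> A])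
qed (simp add: sets)

lemma vector_measure_additive:
  assumes \<mu>: "vector_measure \<mu>" and AB: "A \<in> sets borel" "B \<in> sets borel" "A \<inter> B = {}"
  shows "\<mu> (A \<union> B) = \<mu> A + \<mu> B"
proof -
  have "range (binaryset A B) \<subseteq> sets borel" "disjoint_family (binaryset A B)"
    using AB by (auto simp: binaryset_def disjoint_family_on_def)
  then have "(\<lambda>i. \<mu> (binaryset A B i)) sums \<mu> (A \<union> B)"
    using vector_measure_sums[OF \<mu>, of "binaryset A B"] by (simp add: UN_binaryset_eq)
  moreover have "(\<lambda>i. \<mu> (binaryset A B i)) sums (\<mu> A + \<mu> B)"
    by (rule binaryset_sums) (rule vector_measure_empty[OF \<mu>])
  ultimately show ?thesis
    by (rule sums_unique2)
qed

lemma vector_measure_sum: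
  assumes \<mu>: "vector_measure \<mu>" and "finite I" "\<And>i. i \<in> I \<Longrightarrow> F i \<in> sets borel" "disjoint_family_on F I"
  shows "\<mu> (\<Union>i\<in>I. F i) = (\<Sum>i\<in>I. \<mu> (F i))"
  using assms(2-)
proof (induction I)
  case (insert i I)
  have "\<mu> (F i \<union> (\<Union>j\<in>I. F j)) = \<mu> (F i) + \<mu> (\<Union>j\<in>I. F j)"
    using insert by (intro vector_measure_additive[OF \<mu>]) (auto simp: disjoint_family_on_def)
  then show ?case
    using insert by (simp add: disjoint_family_on_def)
qed (simp add: vector_measure_empty[OF \<mu>])

lemma vector_measure_add:
  assumes "vector_measure \<mu>" "vector_measure \<nu>"
  shows "vector_measure (\<lambda>A. \<mu> A + \<nu> A)"
  using assms by (auto simp: vector_measure_def intro!: sums_add)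

lemma vector_measure_bounded_linear:
  assumes "vector_measure \<mu>" "bounded_linear L"
  shows "vector_measure (\<lambda>A. L (\<mu> A))"
  using assms by (auto simp: vector_measure_def intro: bounded_linear.sums)

text \<open>An infinite upper variation could be split off forever, leaving infinitely many disjoint
  pieces of measure larger than 1 in absolute value.\<close>

lemma emeasure_positive_part_finite:
  assumes \<nu>: "vector_measure \<nu>"
  shows "emeasure (positive_part \<nu>) UNIV < \<infinity>"
proof (rule ccontr)
  assume inf: "\<not> ?thesis"
  let ?M = "positive_part \<nu>"
  define P where "P E \<longleftrightarrow> E \<in> sets borel \<and> emeasure ?M E = \<infinity>" for E
  have step: "\<exists>F. P F \<and> F \<subseteq> E \<and> 1 \<le> \<bar>\<nu> (E - F)\<bar>" if "P E" for E
  proof -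
    have E: "E \<in> sets borel" "emeasure ?M E = \<infinity>" using that by (auto simp: P_def)
    then have "(SUP B \<in> {B \<in> sets borel. B \<subseteq> E}. ennreal (\<nu> B)) = \<infinity>"
      by (simp only: emeasure_positive_part[OF \<nu>] upper_variation_def)
    \<comment> \<open>The margin makes the values of \<open>\<nu>\<close> on \<open>A\<close> and on
      \<open>E - A\<close> at least 1 in absolute value, so whichever of the two keeps infinite
      upper variation can be the next set, and the other is split off.\<close>
    then have "ennreal (1 + \<bar>\<nu> E\<bar>) < (SUP B \<in> {B \<in> sets borel. B \<subseteq> E}. ennreal (\<nu> B))"
      by (simp only: infinity_ennreal_def ennreal_less_top)
    then obtain A where A: "A \<in> sets borel" "A \<subseteq> E" "ennreal (1 + \<bar>\<nu> E\<bar>) < ennreal (\<nu> A)"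
      by (auto simp: less_SUP_iff)
    then have gt: "1 + \<bar>\<nu> E\<bar> < \<nu> A"
      by (metis abs_ge_zero add_nonneg_nonneg ennreal_less_iff zero_le_one)
    have "\<nu> E = \<nu> (E - A) + \<nu> A"
      using vector_measure_additive[OF \<nu>, of "E - A" A] A E by (auto simp: Un_absorb2)
    then have "1 \<le> \<bar>\<nu> (E - A)\<bar>" "1 \<le> \<bar>\<nu> (E - (E - A))\<bar>"
      using gt A(2) by (auto simp: double_diff)
    moreover have "emeasure ?M (E - A) + emeasure ?M A = \<infinity>"
      using A E by (subst plus_emeasure) (auto simp: Un_absorb2)
    then have "P A \<or> P (E - A)"
      using A E by (auto simp: P_def ennreal_add_eq_top)
    ultimately show ?thesis
      using A(2) by (metis Diff_subset)
  qed
  have "P UNIV"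
    using inf by (simp add: P_def flip: top.not_eq_extremum)
  then have "\<exists>E. \<forall>n::nat. P (E n) \<and> (E (Suc n) \<subseteq> E n \<and> 1 \<le> \<bar>\<nu> (E n - E (Suc n))\<bar>)"
    using step by (intro dependent_nat_choice) auto
  then obtain E where E: "\<And>n. P (E n)" "\<And>n. E (Suc n) \<subseteq> E n" "\<And>n. 1 \<le> \<bar>\<nu> (E n - E (Suc n))\<bar>"
    by auto
  define A where "A n = E n - E (Suc n)" for n
  have anti: "E n \<subseteq> E m" if "m \<le> n" for m n
    using that E(2) by (rule lift_Suc_antimono_le[rotated])
  have "disjoint_family A"
    unfolding disjoint_family_on_def
  proof (intro ballI impI)
    fix m n :: nat assume "m \<noteq> n"
    then consider "Suc m \<le> n" | "Suc n \<le> m" by linarith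
    then show "A m \<inter> A n = {}"
      using anti by cases (auto simp: A_def)
  qed
  moreover have "range A \<subseteq> sets borel"
    using E(1) by (auto simp: A_def P_def)
  ultimately have "(\<lambda>n. \<nu> (A n)) sums \<nu> (\<Union>n. A n)"
    using vector_measure_sums[OF \<nu>] by blast
  then have "(\<lambda>n. \<nu> (A n)) \<longlonglongrightarrow> 0"
    using sums_summable summable_LIMSEQ_zero by blast
  then have "\<forall>\<^sub>F n in sequentially. \<bar>\<nu> (A n)\<bar> < 1"
    using order_tendstoD(2)[OF tendsto_rabs_zero, of _ _ 1] by simp
  then show False
    using E(3) by (auto simp: A_def eventually_sequentially not_less[symmetric])
qed

text \<open>The norm is at most the sum of the absolute coordinates, so the total variation is
  dominated by the positive and negative parts of the finitely many coordinates, each of which is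
  finite.\<close>

lemma finite_measure_total_variation:
  fixes \<mu> :: "'a::topological_space set \<Rightarrow> 'b::euclidean_space"
  assumes \<mu>: "vector_measure \<mu>"
  shows "finite_measure (total_variation \<mu>)"
proof
  let ?I = "Basis \<times> {1, - 1} :: ('b \<times> real) set"
  define N where "N = (\<lambda>(c, s). positive_part (\<lambda>A. s * (\<mu> A \<bullet> c)))"
  have vm: "vector_measure (\<lambda>A. s * (\<mu> A \<bullet> c))" for c s
    using \<mu> by (rule vector_measure_bounded_linear)
      (intro bounded_linear_intros)
  have le: "ennreal (s * (\<mu> A \<bullet> c)) \<le> emeasure (N (c, s)) A" if "A \<in> sets borel" for A c s
    unfolding N_def case_prod_conv emeasure_positive_part[OF vm that] upper_variation_def
    using that by (intro SUP_upper) auto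
  have "(\<integral>\<^sup>+x. 1 \<partial>total_variation \<mu>) \<le> (\<Sum>i\<in>?I. \<integral>\<^sup>+x. 1 \<partial>N i)"
  proof (rule nn_integral_total_variation_le[OF \<mu>])
    fix A :: "'a set" assume A: "A \<in> sets borel"
    have "ennreal (norm (\<mu> A)) \<le> (\<Sum>c\<in>Basis. ennreal \<bar>\<mu> A \<bullet> c\<bar>)"
      using norm_le_l1[of "\<mu> A"] by (simp add: ennreal_leI)
    also have "\<dots> \<le> (\<Sum>c\<in>Basis. \<Sum>s\<in>{1, - 1}. emeasure (N (c, s)) A)"
    proof (rule sum_mono)
      fix c :: 'b
      have "ennreal \<bar>\<mu> A \<bullet> c\<bar> \<le> ennreal (1 * (\<mu> A \<bullet> c)) + ennreal (- 1 * (\<mu> A \<bullet> c))"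
        by (cases "\<mu> A \<bullet> c \<ge> 0") (auto simp: ennreal_neg)
      also have "\<dots> \<le> emeasure (N (c, 1)) A + emeasure (N (c, - 1)) A"
        by (intro add_mono le A)
      finally show "ennreal \<bar>\<mu> A \<bullet> c\<bar> \<le> (\<Sum>s\<in>{1, - 1}. emeasure (N (c, s)) A)"
        by simp
    qed
    also have "\<dots> = (\<Sum>i\<in>?I. emeasure (N i) A)"
      unfolding sum.cartesian_product by (intro sum.cong) auto
    finally show "ennreal (norm (\<mu> A)) \<le> (\<Sum>i\<in>?I. emeasure (N i) A)" .
  qed (auto simp: N_def)
  also have "\<dots> < \<infinity>"
    using emeasure_positive_part_finite[OF vm]
    by (auto simp: ennreal_sum_less_top N_def sets_eq_imp_space_eq[OF sets_positive_part])
  finally show "emeasure (total_variation \<mu>) (space (total_variation \<mu>)) \<noteq> \<infinity>"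
    by simp
qed

section \<open>Measures with a density\<close>

text \<open>The image under \<open>T\<close> of the vector measure with density \<open>G\<close>
  with respect to \<open>M\<close>. The identity map will give \<open>\<mu>\<close>; maps into the
  product space will give couplings.\<close>

definition pushforward :: "'c measure \<Rightarrow> ('c \<Rightarrow> 'a) \<Rightarrow> ('c \<Rightarrow> 'b) \<Rightarrow> 'a set \<Rightarrow> 'b::{banach, second_countable_topology}" where
  "pushforward M T G A = (LINT x|M. indicator A (T x) *\<^sub>R G x)"

lemma integrable_indicator_comp:
  fixes G :: "'c \<Rightarrow> 'b::{banach, second_countable_topology}"
  assumes T [measurable]: "T \<in> M \<rightarrow>\<^sub>M N" and G: "integrable M G" and A [measurable]: "A \<in> sets N"
  shows "integrable M (\<lambda>x. indicator A (T x) *\<^sub>R G x)"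
proof -
  have [measurable]: "G \<in> borel_measurable M" using G by simp
  show ?thesis
    by (rule Bochner_Integration.integrable_bound[OF G]) (auto split: split_indicator)
qed

lemma vector_measure_pushforward:
  assumes T [measurable]: "T \<in> M \<rightarrow>\<^sub>M borel" and G: "integrable M G"
  shows "vector_measure (pushforward M T G)"
  unfolding vector_measure_def
proof (intro allI impI)
  fix A :: "nat \<Rightarrow> 'b set"
  assume A: "range A \<subseteq> sets borel" "disjoint_family A"
  have [measurable]: "A i \<in> sets borel" for i using A(1) by auto
  have [measurable]: "G \<in> borel_measurable M" using G by simp
  have "(\<lambda>n. LINT x|M. indicator (\<Union>i<n. A i) (T x) *\<^sub>R G x)
      \<longlonglongrightarrow> (LINT x|M. indicator (\<Union>i. A i) (T x) *\<^sub>R G x)"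
  proof (rule integral_dominated_convergence[where w = "\<lambda>x. norm (G x)"])
    show "AE x in M. (\<lambda>n. indicator (\<Union>i<n. A i) (T x) *\<^sub>R G x)
        \<longlonglongrightarrow> indicator (\<Union>i. A i) (T x) *\<^sub>R G x"
      by (intro AE_I2 tendsto_scaleR tendsto_const LIMSEQ_indicator_UN)
  qed (use G A(1) in \<open>auto intro!: borel_measurable_integrable integrable_indicator_comp[OF T G] sets.countable_UN sets.finite_UN
      split: split_indicator\<close>)
  moreover have "(LINT x|M. indicator (\<Union>i<n. A i) (T x) *\<^sub>R G x) = (\<Sum>i<n. pushforward M T G (A i))" for n
  proof -
    have "indicator (\<Union>i<n. A i) y = (\<Sum>i<n. indicator (A i) y :: real)" for y
      using A(2) by (intro indicator_UN_disjoint) (auto simp: disjoint_family_on_def)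
    then have "(LINT x|M. indicator (\<Union>i<n. A i) (T x) *\<^sub>R G x)
        = (LINT x|M. (\<Sum>i<n. indicator (A i) (T x) *\<^sub>R G x))"
      by (simp only: scaleR_sum_left)
    also have "\<dots> = (\<Sum>i<n. pushforward M T G (A i))"
      unfolding pushforward_def
      by (intro Bochner_Integration.integral_sum integrable_indicator_comp[OF T G]) simp
    finally show ?thesis .
  qed
  ultimately show "(\<lambda>i. pushforward M T G (A i)) sums pushforward M T G (\<Union>i. A i)"
    by (simp add: sums_def pushforward_def)
qed

lemma norm_pushforward_le:
  assumes T [measurable]: "T \<in> M \<rightarrow>\<^sub>M borel" and G: "integrable M G" and A [measurable]: "A \<in> sets borel"
  shows "ennreal (norm (pushforward M T G A)) \<le> emeasure (distr (density M (\<lambda>x. norm (G x))) borel T) A"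
proof -
  have [measurable]: "G \<in> borel_measurable M" using G by simp
  have "ennreal (norm (pushforward M T G A)) \<le> (\<integral>\<^sup>+x. norm (indicator A (T x) *\<^sub>R G x) \<partial>M)"
    unfolding pushforward_def
    by (rule integral_norm_bound_ennreal) (rule integrable_indicator_comp[OF T G A])
  also have "\<dots> = emeasure (distr (density M (\<lambda>x. norm (G x))) borel T) A"
    by (simp add: emeasure_distr emeasure_density)
      (intro nn_integral_cong, auto split: split_indicator)
  finally show ?thesis .
qed

text \<open>The couplings constructed later are sums of two pushforwards. By the triangle inequality
  their variation is at most the sum of the images of the scalar densities \<open>norm (G x)\<close>
  and \<open>norm (G' x)\<close>.\<close>

lemma nn_integral_total_variation_pushforward_add_le:
  assumes T: "T \<in> M \<rightarrow>\<^sub>M borel" "T' \<in> M \<rightarrow>\<^sub>M borel" and G: "integrable M G" "integrable M G'"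
    and \<phi> [measurable]: "\<phi> \<in> borel_measurable borel"
  shows "(\<integral>\<^sup>+y. \<phi> y \<partial>total_variation (\<lambda>A. pushforward M T G A + pushforward M T' G' A))
    \<le> (\<integral>\<^sup>+x. ennreal (norm (G x)) * \<phi> (T x) \<partial>M) + (\<integral>\<^sup>+x. ennreal (norm (G' x)) * \<phi> (T' x) \<partial>M)"
proof -
  have [measurable]: "G \<in> borel_measurable M" "G' \<in> borel_measurable M" using G by simp_all
  note T [measurable]
  define N where "N b = (if b then distr (density M (\<lambda>x. ennreal (norm (G x)))) borel T
    else distr (density M (\<lambda>x. ennreal (norm (G' x)))) borel T')" for b
  have "(\<integral>\<^sup>+y. \<phi> y \<partial>total_variation (\<lambda>A. pushforward M T G A + pushforward M T' G' A))
      \<le> (\<Sum>b\<in>UNIV. \<integral>\<^sup>+y. \<phi> y \<partial>N b)"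
  proof (rule nn_integral_total_variation_le)
    fix A :: "'b set" assume A: "A \<in> sets borel"
    have "ennreal (norm (pushforward M T G A + pushforward M T' G' A))
        \<le> ennreal (norm (pushforward M T G A)) + ennreal (norm (pushforward M T' G' A))"
      by (simp add: norm_triangle_ineq flip: ennreal_plus)
    also have "\<dots> \<le> (\<Sum>b\<in>UNIV. emeasure (N b) A)"
      unfolding UNIV_bool N_def
      using norm_pushforward_le[OF T(1) G(1) A] norm_pushforward_le[OF T(2) G(2) A]
      by (simp add: add_mono add.commute)
    finally show "ennreal (norm (pushforward M T G A + pushforward M T' G' A))
        \<le> (\<Sum>b\<in>UNIV. emeasure (N b) A)" .
  qed (auto simp: N_def intro: vector_measure_add vector_measure_pushforward T G)
  also have "\<dots> = (\<integral>\<^sup>+x. ennreal (norm (G x)) * \<phi> (T x) \<partial>M) + (\<integral>\<^sup>+x. ennreal (norm (G' x)) * \<phi> (T' x) \<partial>M)"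
    unfolding UNIV_bool N_def
    by (simp add: nn_integral_distr nn_integral_density add.commute)
  finally show ?thesis .
qed

section \<open>Integration against measures with a density\<close>

text \<open>The set \<open>{x. 0 < f x}\<close> is the positive set of a Hahn decomposition, so the
  supremum defining the upper variation is attained at its intersection with
  \<open>A\<close>.\<close>

lemma positive_part_pushforward:
  fixes f :: "'a::euclidean_space \<Rightarrow> real"
  assumes f: "integrable lborel f"
  shows "positive_part (pushforward lborel (\<lambda>x. x) f) = density lborel (\<lambda>x. ennreal (f x))"
proof (rule measure_eqI)
  fix A assume "A \<in> sets (positive_part (pushforward lborel (\<lambda>x. x) f))"
  then have A [measurable]: "A \<in> sets borel" by simp
  have [measurable]: "f \<in> borel_measurable borel" using f by simp
  have le: "ennreal (pushforward lborel (\<lambda>x. x) f B) \<le> emeasure (density lborel (\<lambda>x. ennreal (f x))) B"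
    if [measurable]: "B \<in> sets borel" for B
  proof -
    have int: "integrable lborel (\<lambda>x. indicator B x *\<^sub>R f x)"
      using integrable_indicator_comp[OF _ f that, of "\<lambda>x. x"] by simp
    have "ennreal (pushforward lborel (\<lambda>x. x) f B) \<le> ennreal (LINT x|lborel. max 0 (indicator B x *\<^sub>R f x))"
      unfolding pushforward_def using int by (intro ennreal_leI integral_mono) auto
    also have "\<dots> = (\<integral>\<^sup>+x. ennreal (max 0 (indicator B x *\<^sub>R f x)) \<partial>lborel)"
      using int by (intro nn_integral_eq_integral[symmetric]) auto
    also have "\<dots> = emeasure (density lborel (\<lambda>x. ennreal (f x))) B"
      by (subst emeasure_density) (auto intro!: nn_integral_cong simp: max_def ennreal_neg split: split_indicator)
    finally show ?thesis .
  qed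
  have vm: "vector_measure (pushforward lborel (\<lambda>x. x) f)"
    using f by (intro vector_measure_pushforward) auto
  show "emeasure (positive_part (pushforward lborel (\<lambda>x. x) f)) A = emeasure (density lborel (\<lambda>x. ennreal (f x))) A"
    unfolding emeasure_positive_part[OF vm A] upper_variation_def
  proof (intro antisym SUP_least)
    fix B assume B: "B \<in> {B \<in> sets borel. B \<subseteq> A}"
    then show "ennreal (pushforward lborel (\<lambda>x. x) f B) \<le> emeasure (density lborel (\<lambda>x. ennreal (f x))) A"
      by (intro order_trans[OF le emeasure_mono]) auto
  next
    let ?B = "A \<inter> {x. 0 < f x}"
    have [measurable]: "?B \<in> sets borel" by measurable
    have int: "integrable lborel (\<lambda>x. indicator ?B x *\<^sub>R f x)"
      using integrable_indicator_comp[OF _ f, of "\<lambda>x. x" borel ?B] by simp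
    have "emeasure (density lborel (\<lambda>x. ennreal (f x))) A = (\<integral>\<^sup>+x. ennreal (indicator ?B x *\<^sub>R f x) \<partial>lborel)"
      by (subst emeasure_density) (auto intro!: nn_integral_cong simp: ennreal_neg split: split_indicator)
    also have "\<dots> = ennreal (pushforward lborel (\<lambda>x. x) f ?B)"
      unfolding pushforward_def using int
      by (intro nn_integral_eq_integral) (auto split: split_indicator)
    also have "\<dots> \<le> (SUP B \<in> {B \<in> sets borel. B \<subseteq> A}. ennreal (pushforward lborel (\<lambda>x. x) f B))"
      by (intro SUP_upper) auto
    finally show "emeasure (density lborel (\<lambda>x. ennreal (f x))) A
      \<le> (SUP B \<in> {B \<in> sets borel. B \<subseteq> A}. ennreal (pushforward lborel (\<lambda>x. x) f B))" .
  qed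
qed simp

lemma signed_integral_cong:
  assumes "\<And>A. A \<in> sets borel \<Longrightarrow> \<mu> A = \<nu> A"
  shows "signed_integral \<mu> v = signed_integral \<nu> v"
proof -
  have "upper_variation \<mu> = upper_variation \<nu>" "upper_variation (\<lambda>A. - \<mu> A) = upper_variation (\<lambda>A. - \<nu> A)"
    using assms by (auto simp: upper_variation_def fun_eq_iff intro!: SUP_cong)
  then show ?thesis
    by (simp add: signed_integral_def positive_part_def)
qed

lemma signed_integral_pushforward:
  fixes f v :: "'a::euclidean_space \<Rightarrow> real"
  assumes f: "integrable lborel f" and v [measurable]: "v \<in> borel_measurable borel"
    and int: "integrable lborel (\<lambda>x. f x * v x)"
  shows "signed_integral (pushforward lborel (\<lambda>x. x) f) v = (LINT x|lborel. f x * v x)"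
proof -
  have [measurable]: "f \<in> borel_measurable borel" using f by simp
  have pp: "integral\<^sup>L (density lborel (\<lambda>x. ennreal (g x))) v = (LINT x|lborel. max 0 (g x) * v x)"
    if [measurable]: "g \<in> borel_measurable borel" for g :: "'a \<Rightarrow> real"
  proof -
    have "(\<lambda>x. ennreal (g x)) = (\<lambda>x. ennreal (max 0 (g x)))"
      by (auto simp: max_def ennreal_neg)
    then show ?thesis
      by (simp add: integral_density)
  qed
  have bd: "integrable lborel (\<lambda>x. max 0 (f x) * v x)" "integrable lborel (\<lambda>x. max 0 (- f x) * v x)"
    by (rule Bochner_Integration.integrable_bound[OF int]; auto simp: max_def abs_mult mult_nonpos_nonneg)+
  have neg: "(\<lambda>A. - pushforward lborel (\<lambda>x. x) f A) = pushforward lborel (\<lambda>x. x) (\<lambda>x. - f x)"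
    by (simp add: pushforward_def fun_eq_iff)
  have "signed_integral (pushforward lborel (\<lambda>x. x) f) v
      = (LINT x|lborel. max 0 (f x) * v x) - (LINT x|lborel. max 0 (- f x) * v x)"
    unfolding signed_integral_def neg using f by (simp add: positive_part_pushforward pp)
  also have "\<dots> = (LINT x|lborel. max 0 (f x) * v x - max 0 (- f x) * v x)"
    using bd by (rule Bochner_Integration.integral_diff[symmetric])
  also have "\<dots> = (LINT x|lborel. f x * v x)"
    by (intro Bochner_Integration.integral_cong) (auto simp: max_def)
  finally show ?thesis .
qed

lemma vector_integral_pushforward:
  fixes f v :: "'a::euclidean_space \<Rightarrow> 'b::euclidean_space"
  assumes f: "integrable lborel f" and v [measurable]: "v \<in> borel_measurable borel"
    and int: "integrable lborel (\<lambda>x. norm (v x) * norm (f x))"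
  shows "vector_integral (pushforward lborel (\<lambda>x. x) f) v = (LINT x|lborel. v x \<bullet> f x)"
proof -
  have [measurable]: "f \<in> borel_measurable borel" using f by simp
  have comp: "integrable lborel (\<lambda>x. (f x \<bullet> b) * (v x \<bullet> b))" if "b \<in> Basis" for b
  proof (rule Bochner_Integration.integrable_bound[OF int])
    show "AE x in lborel. norm ((f x \<bullet> b) * (v x \<bullet> b)) \<le> norm (norm (v x) * norm (f x))"
      using that by (auto simp: abs_mult mult.commute intro!: AE_I2 mult_mono Basis_le_norm)
  qed simp
  have "signed_integral (\<lambda>A. pushforward lborel (\<lambda>x. x) f A \<bullet> b) (\<lambda>x. v x \<bullet> b)
      = (LINT x|lborel. (f x \<bullet> b) * (v x \<bullet> b))" if "b \<in> Basis" for b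
  proof -
    \<comment> \<open>The two set functions are compared on Borel sets only, where the inner product
      with \<open>b\<close> can be pulled out of the integral.\<close>
    have "signed_integral (\<lambda>A. pushforward lborel (\<lambda>x. x) f A \<bullet> b) (\<lambda>x. v x \<bullet> b)
        = signed_integral (pushforward lborel (\<lambda>x. x) (\<lambda>x. f x \<bullet> b)) (\<lambda>x. v x \<bullet> b)"
      using integrable_indicator_comp[OF _ f, of "\<lambda>x. x" borel]
      by (intro signed_integral_cong) (simp add: pushforward_def flip: integral_inner_left)
    then show ?thesis
      using that f comp by (simp add: signed_integral_pushforward)
  qed
  then have "vector_integral (pushforward lborel (\<lambda>x. x) f) v
      = (\<Sum>b\<in>Basis. (LINT x|lborel. (f x \<bullet> b) * (v x \<bullet> b)))"
    by (simp add: vector_integral_def)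
  also have "\<dots> = (LINT x|lborel. (\<Sum>b\<in>Basis. (f x \<bullet> b) * (v x \<bullet> b)))"
    using comp by (intro Bochner_Integration.integral_sum[symmetric]) auto
  also have "\<dots> = (LINT x|lborel. v x \<bullet> f x)"
    by (intro Bochner_Integration.integral_cong refl)
      (simp only: euclidean_inner[of "v _" "f _"] mult.commute)
  finally show ?thesis .
qed

section \<open>The duality bound for couplings\<close>

lemma norm_le_measure_total_variation:
  fixes \<mu> :: "'a::topological_space set \<Rightarrow> 'b::euclidean_space"
  assumes \<mu>: "vector_measure \<mu>" and A: "A \<in> sets borel"
  shows "norm (\<mu> A) \<le> measure (total_variation \<mu>) A"
proof -
  interpret finite_measure "total_variation \<mu>"
    by (rule finite_measure_total_variation[OF \<mu>])
  have "ennreal (norm (\<mu> A)) \<le> variation \<mu> A"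
  proof (cases "A = {}")
    case False
    then show ?thesis
      using variation_upper[of "{A}" A \<mu>] A by (simp add: partition_on_def)
  qed (simp add: vector_measure_empty[OF \<mu>])
  then show ?thesis
    using \<mu> A by (simp add: emeasure_eq_measure flip: emeasure_total_variation)
qed

text \<open>On the level sets of \<open>s\<close> the marginal condition turns the left side into a
  double sum of \<open>(c - d) \<bullet> \<pi> (A c \<times> A d)\<close>. Cauchy-Schwarz on each
  rectangle then gives a discrete form of weak duality.\<close>

lemma simple_inner_integral_coupling_le:
  fixes f s :: "'a::euclidean_space \<Rightarrow> 'b::euclidean_space"
  assumes f: "integrable lborel f" and s: "simple_function borel s"
    and \<pi>: "\<pi> \<in> couplings (pushforward lborel (\<lambda>x. x) f)"
  shows "(LINT x|lborel. s x \<bullet> f x) \<le> (LINT z|total_variation \<pi>. norm (s (fst z) - s (snd z)))"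
proof -
  have vm: "vector_measure \<pi>" and marg: "\<And>A. A \<in> sets borel \<Longrightarrow>
      \<pi> (A \<times> UNIV) - \<pi> (UNIV \<times> A) = pushforward lborel (\<lambda>x. x) f A"
    using \<pi> by (auto simp: couplings_def)
  interpret finite_measure "total_variation \<pi>"
    by (rule finite_measure_total_variation[OF vm])
  define R where "R = range s"
  define A where "A c = s -` {c}" for c
  have R: "finite R" and A [measurable]: "A c \<in> sets borel" for c
    using simple_functionD[OF s] by (auto simp: R_def A_def)
  have AA [measurable]: "A c \<times> A d \<in> sets borel" for c d
    by (intro borel_Times A)
  have UN: "(\<Union>c\<in>R. A c) = UNIV" by (auto simp: R_def A_def)
  have int: "integrable lborel (\<lambda>x. indicator (A c) x *\<^sub>R f x)" for c
    using integrable_indicator_comp[OF _ f A] by simp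
  have "s x \<bullet> f x = (\<Sum>c\<in>R. c \<bullet> (indicator (A c) x *\<^sub>R f x))" for x
  proof -
    have "(\<Sum>c\<in>R. c \<bullet> (indicator (A c) x *\<^sub>R f x)) = (\<Sum>c\<in>R. if c = s x then s x \<bullet> f x else 0)"
      by (intro sum.cong) (auto simp: A_def indicator_def)
    then show ?thesis
      using R by (simp add: R_def)
  qed
  then have "(LINT x|lborel. s x \<bullet> f x) = (LINT x|lborel. (\<Sum>c\<in>R. c \<bullet> (indicator (A c) x *\<^sub>R f x)))"
    by simp
  also have "\<dots> = (\<Sum>c\<in>R. c \<bullet> pushforward lborel (\<lambda>x. x) f (A c))"
    unfolding pushforward_def using int
    by (subst Bochner_Integration.integral_sum) (auto simp del: inner_scaleR_right)
  also have "\<dots> = (\<Sum>c\<in>R. c \<bullet> \<pi> (A c \<times> UNIV)) - (\<Sum>c\<in>R. c \<bullet> \<pi> (UNIV \<times> A c))"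
    by (simp add: inner_diff_right sum_subtractf marg[OF A, symmetric])
  \<comment> \<open>Both marginals are cut along the same grid of rectangles, so that their
    difference can be taken cell by cell.\<close>
  also have "(\<Sum>c\<in>R. c \<bullet> \<pi> (A c \<times> UNIV)) = (\<Sum>c\<in>R. \<Sum>d\<in>R. c \<bullet> \<pi> (A c \<times> A d))"
  proof (intro sum.cong refl)
    fix c
    have "\<pi> (\<Union>d\<in>R. A c \<times> A d) = (\<Sum>d\<in>R. \<pi> (A c \<times> A d))"
      using R AA by (intro vector_measure_sum[OF vm]) (auto simp: disjoint_family_on_def A_def)
    moreover have "(\<Union>d\<in>R. A c \<times> A d) = A c \<times> UNIV" using UN by auto
    ultimately show "c \<bullet> \<pi> (A c \<times> UNIV) = (\<Sum>d\<in>R. c \<bullet> \<pi> (A c \<times> A d))"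
      by (simp add: inner_sum_right)
  qed
  also have "(\<Sum>c\<in>R. c \<bullet> \<pi> (UNIV \<times> A c)) = (\<Sum>d\<in>R. \<Sum>c\<in>R. d \<bullet> \<pi> (A c \<times> A d))"
  proof (intro sum.cong refl)
    fix d
    have "\<pi> (\<Union>c\<in>R. A c \<times> A d) = (\<Sum>c\<in>R. \<pi> (A c \<times> A d))"
      using R AA by (intro vector_measure_sum[OF vm]) (auto simp: disjoint_family_on_def A_def)
    moreover have "(\<Union>c\<in>R. A c \<times> A d) = UNIV \<times> A d" using UN by auto
    ultimately show "d \<bullet> \<pi> (UNIV \<times> A d) = (\<Sum>c\<in>R. d \<bullet> \<pi> (A c \<times> A d))"
      by (simp add: inner_sum_right)
  qed
  also have "(\<Sum>d\<in>R. \<Sum>c\<in>R. d \<bullet> \<pi> (A c \<times> A d)) = (\<Sum>c\<in>R. \<Sum>d\<in>R. d \<bullet> \<pi> (A c \<times> A d))"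
    by (rule sum.swap)
  also have "(\<Sum>c\<in>R. \<Sum>d\<in>R. c \<bullet> \<pi> (A c \<times> A d)) - \<dots> = (\<Sum>c\<in>R. \<Sum>d\<in>R. (c - d) \<bullet> \<pi> (A c \<times> A d))"
    by (simp add: inner_diff_left sum_subtractf)
  also have "\<dots> \<le> (\<Sum>c\<in>R. \<Sum>d\<in>R. norm (c - d) * measure (total_variation \<pi>) (A c \<times> A d))"
  proof (intro sum_mono)
    fix c d
    have "(c - d) \<bullet> \<pi> (A c \<times> A d) \<le> norm (c - d) * norm (\<pi> (A c \<times> A d))"
      by (rule norm_cauchy_schwarz)
    also have "\<dots> \<le> norm (c - d) * measure (total_variation \<pi>) (A c \<times> A d)"
      by (intro mult_left_mono norm_le_measure_total_variation[OF vm]) auto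
    finally show "(c - d) \<bullet> \<pi> (A c \<times> A d) \<le> norm (c - d) * measure (total_variation \<pi>) (A c \<times> A d)" .
  qed
  also have "\<dots> = (LINT z|total_variation \<pi>. (\<Sum>c\<in>R. \<Sum>d\<in>R. norm (c - d) * indicator (A c \<times> A d) z))"
    by (simp add: less_top[symmetric] emeasure_finite)
  also have "\<dots> = (LINT z|total_variation \<pi>. norm (s (fst z) - s (snd z)))"
  proof (intro Bochner_Integration.integral_cong refl)
    fix z
    have "(\<Sum>c\<in>R. \<Sum>d\<in>R. norm (c - d) * indicator (A c \<times> A d) z)
        = (\<Sum>c\<in>R. if c = s (fst z) then \<Sum>d\<in>R. if d = s (snd z) then norm (s (fst z) - s (snd z)) else 0 else 0)"
      by (intro sum.cong refl) (auto simp: A_def indicator_def mem_Times_iff intro!: sum.cong sum.neutral)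
    then show "(\<Sum>c\<in>R. \<Sum>d\<in>R. norm (c - d) * indicator (A c \<times> A d) z) = norm (s (fst z) - s (snd z))"
      using R by (simp add: R_def)
  qed
  finally show ?thesis .
qed

text \<open>Simple functions with \<open>norm (s i x) \<le> 2 * norm (u x)\<close> converge to
  \<open>u\<close> pointwise. Boundedness gives integrable majorants on both sides: a multiple of
  \<open>norm (f x)\<close>, and a constant, since the total variation is finite.\<close>

lemma bounded_inner_integral_coupling_le:
  fixes f u :: "'a::euclidean_space \<Rightarrow> 'b::euclidean_space"
  assumes f: "integrable lborel f" and u [measurable]: "u \<in> borel_measurable borel"
    and C: "\<And>x. norm (u x) \<le> C"
    and \<pi>: "\<pi> \<in> couplings (pushforward lborel (\<lambda>x. x) f)"
  shows "(LINT x|lborel. u x \<bullet> f x) \<le> (LINT z|total_variation \<pi>. norm (u (fst z) - u (snd z)))"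
proof -
  interpret finite_measure "total_variation \<pi>"
    using \<pi> by (intro finite_measure_total_variation) (auto simp: couplings_def)
  have [measurable]: "f \<in> borel_measurable borel" using f by simp
  obtain s where s: "\<And>i::nat. simple_function borel (s i)" "\<And>x. (\<lambda>i. s i x) \<longlonglongrightarrow> u x"
      "\<And>i x. norm (s i x) \<le> 2 * norm (u x)"
    using borel_measurable_implies_sequence_metric[OF u, of 0] by (auto simp: dist_0_norm)
  note [measurable] = borel_measurable_simple_function[OF s(1)]
  have bd: "norm (s i x) \<le> 2 * C" for i x
    using s(3)[of i x] C[of x] by simp
  have [measurable]: "fst \<in> borel \<rightarrow>\<^sub>M (borel :: 'a measure)" "snd \<in> borel \<rightarrow>\<^sub>M (borel :: 'a measure)"
    by (auto intro!: borel_measurable_continuous_onI continuous_intros)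
  have "(\<lambda>i. LINT x|lborel. s i x \<bullet> f x) \<longlonglongrightarrow> (LINT x|lborel. u x \<bullet> f x)"
  proof (rule integral_dominated_convergence[where w = "\<lambda>x. 2 * C * norm (f x)"])
    show "AE x in lborel. norm (s i x \<bullet> f x) \<le> 2 * C * norm (f x)" for i
    proof (rule AE_I2)
      fix x
      have "\<bar>s i x \<bullet> f x\<bar> \<le> norm (s i x) * norm (f x)"
        by (rule Cauchy_Schwarz_ineq2)
      also have "\<dots> \<le> 2 * C * norm (f x)"
        by (intro mult_right_mono bd) simp
      finally show "norm (s i x \<bullet> f x) \<le> 2 * C * norm (f x)"
        by simp
    qed
  qed (use f s(2) in \<open>auto intro!: AE_I2 tendsto_intros\<close>)
  moreover have "(\<lambda>i. LINT z|total_variation \<pi>. norm (s i (fst z) - s i (snd z)))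
      \<longlonglongrightarrow> (LINT z|total_variation \<pi>. norm (u (fst z) - u (snd z)))"
  proof (rule integral_dominated_convergence[where w = "\<lambda>z. 4 * C"])
    show "AE z in total_variation \<pi>. norm (norm (s i (fst z) - s i (snd z))) \<le> 4 * C" for i
    proof (rule AE_I2)
      fix z
      show "norm (norm (s i (fst z) - s i (snd z))) \<le> 4 * C"
        using norm_triangle_ineq4[of "s i (fst z)" "s i (snd z)"] bd[of i "fst z"] bd[of i "snd z"] by simp
    qed
  qed (use s(2) in \<open>auto intro!: AE_I2 tendsto_intros\<close>)
  ultimately show ?thesis
    by (rule LIMSEQ_le) (use simple_inner_integral_coupling_le[OF f s(1) \<pi>] in blast)
qed

section \<open>Translations, compact supports and null sets\<close>

lemma lborel_integral_translate:
  fixes F :: "'a::euclidean_space \<Rightarrow> 'b::{banach, second_countable_topology}"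
  assumes [measurable]: "F \<in> borel_measurable borel"
  shows "(LINT x|lborel. F (x + c)) = (LINT x|lborel. F x)"
proof -
  have "(LINT x|lborel. F x) = integral\<^sup>L (distr lborel borel ((+) c)) F"
    by (simp add: lborel_distr_plus)
  also have "\<dots> = (LINT x|lborel. F (x + c))"
    by (subst integral_distr) (auto simp: add.commute)
  finally show ?thesis ..
qed

lemma integrable_inner_compact_support:
  fixes v F :: "'a::euclidean_space \<Rightarrow> 'b::euclidean_space"
  assumes v: "continuous_on UNIV v" and F [measurable]: "F \<in> borel_measurable borel"
    and le: "\<And>x. norm (F x) \<le> C * indicator (cbox l r) x"
  shows "integrable lborel (\<lambda>x. v x \<bullet> F x)"
proof -
  have "bounded (v ` cbox l r)"
    by (intro compact_imp_bounded compact_continuous_image continuous_on_subset[OF v]) auto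
  then obtain B where B: "\<And>x. x \<in> cbox l r \<Longrightarrow> norm (v x) \<le> B" "0 < B"
    by (auto simp: bounded_pos)
  have [measurable]: "v \<in> borel_measurable borel"
    by (rule borel_measurable_continuous_onI[OF v])
  show ?thesis
  proof (rule Bochner_Integration.integrable_bound)
    show "integrable lborel (\<lambda>x. B * C * indicator (cbox l r) x :: real)"
      by (auto intro!: integrable_mult_right integrable_real_indicator simp: emeasure_lborel_cbox_finite[unfolded infinity_ennreal_def])
    have "\<bar>v x \<bullet> F x\<bar> \<le> \<bar>B * C * indicator (cbox l r) x\<bar>" for x
    proof (cases "x \<in> cbox l r")
      case True
      have "\<bar>v x \<bullet> F x\<bar> \<le> norm (v x) * norm (F x)"
        by (rule Cauchy_Schwarz_ineq2)
      also have "\<dots> \<le> B * C"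
        using B(1)[of x] B(2) le[of x] True by (intro mult_mono) auto
      finally show ?thesis
        using True by simp
    next
      case False
      then show ?thesis using le[of x] by simp
    qed
    then show "AE x in lborel. norm (v x \<bullet> F x) \<le> norm (B * C * indicator (cbox l r) x)"
      by simp
  qed measurable
qed

lemma integrable_norm_compact_support:
  fixes F :: "'a::euclidean_space \<Rightarrow> 'b::euclidean_space" and \<phi> :: "'a \<Rightarrow> real"
  assumes "continuous_on UNIV \<phi>" and F [measurable]: "F \<in> borel_measurable borel"
    and "\<And>x. norm (F x) \<le> C * indicator (cbox l r) x"
  shows "integrable lborel (\<lambda>x. \<phi> x * norm (F x))"
  using integrable_inner_compact_support[of \<phi> "\<lambda>x. norm (F x)" C l r] assms by simp

text \<open>A Lebesgue null set contains no nonempty open set, so the points of \<open>S\<close>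
  lying in \<open>C\<close> are dense in \<open>S\<close>. The case of empty \<open>C\<close>
  expresses that a nonempty open set is not null.\<close>

lemma AE_lborel_open_imp_closed:
  fixes x :: "'a::euclidean_space"
  assumes "open S" "closed C" "AE x in lborel. x \<in> S \<longrightarrow> x \<in> C" "x \<in> S"
  shows "x \<in> C"
  using assms by (intro mem_closed_if_AE_lebesgue_open[OF assms(1,2)]) (auto simp: AE_completion_iff)

lemma lborel_integrable_translate:
  fixes F :: "'a::euclidean_space \<Rightarrow> 'b::{banach, second_countable_topology}"
  assumes "integrable lborel F"
  shows "integrable lborel (\<lambda>x. F (x + c))"
  using assms integrable_distr_eq[of "(+) c" lborel borel F] lborel_distr_plus[of c]
  by (simp add: add.commute borel_measurable_integrable)

section \<open>Isometric segments, leaves and transport sets\<close>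

lemma lipschitz_on_1_norm_diff:
  "1-lipschitz_on UNIV v \<Longrightarrow> norm (v x - v y) \<le> norm (x - y)"
  using lipschitz_onD[of 1 UNIV v x y] by (simp add: dist_norm)

text \<open>The Lipschitz bounds from both ends force equality in the triangle inequality for the
  three image points; in an inner product space this puts the middle one on the segment.\<close>

lemma lipschitz_1_segment:
  fixes v :: "'a::real_normed_vector \<Rightarrow> 'b::real_inner"
  assumes v: "1-lipschitz_on UNIV v" and eq: "dist (v p) (v (p + d)) = norm d" and t: "0 \<le> t" "t \<le> 1"
  shows "v (p + t *\<^sub>R d) = v p + t *\<^sub>R (v (p + d) - v p)"
proof -
  let ?x = "v (p + t *\<^sub>R d) - v p" and ?z = "v (p + d) - v p" and ?D = "norm d"
  have z: "norm ?z = ?D"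
    using eq by (simp add: dist_norm norm_minus_commute)
  have x: "norm ?x \<le> t * ?D"
    using lipschitz_onD[OF v, of "p + t *\<^sub>R d" p] t by (simp add: dist_norm)
  have "p + d - (p + t *\<^sub>R d) = (1 - t) *\<^sub>R d"
    by (simp add: algebra_simps)
  then have zx: "norm (?z - ?x) \<le> (1 - t) * ?D"
    using lipschitz_onD[OF v, of "p + d" "p + t *\<^sub>R d"] t by (simp add: dist_norm)
  have "(norm (?z - ?x))\<^sup>2 \<le> ((1 - t) * ?D)\<^sup>2" "(norm ?x)\<^sup>2 \<le> (t * ?D)\<^sup>2"
    using x zx t by (auto intro!: power_mono)
  moreover have "(norm (?z - ?x))\<^sup>2 = ?D\<^sup>2 - 2 * (?x \<bullet> ?z) + (norm ?x)\<^sup>2"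
    unfolding z[symmetric] power2_norm_eq_inner by (simp add: inner_diff_left inner_diff_right inner_commute)
  ultimately have inner: "?D\<^sup>2 + (norm ?x)\<^sup>2 - ((1 - t) * ?D)\<^sup>2 \<le> 2 * (?x \<bullet> ?z)"
    by simp
  \<comment> \<open>The deviation from the affine point is expanded. Inserting the lower bound for
    \<open>?x \<bullet> ?z\<close> leaves a nonnegative multiple of
    \<open>(norm ?x)\<^sup>2 - (t * ?D)\<^sup>2\<close>, which is at most 0.\<close>
  have "(norm (?x - t *\<^sub>R ?z))\<^sup>2 = (norm ?x)\<^sup>2 - t * (2 * (?x \<bullet> ?z)) + t\<^sup>2 * ?D\<^sup>2"
    unfolding z[symmetric] power2_norm_eq_inner
    by (simp add: inner_diff_left inner_diff_right inner_commute power2_eq_square algebra_simps)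
  also have "\<dots> \<le> (norm ?x)\<^sup>2 - t * (?D\<^sup>2 + (norm ?x)\<^sup>2 - ((1 - t) * ?D)\<^sup>2) + t\<^sup>2 * ?D\<^sup>2"
    using mult_left_mono[OF inner t(1)] by simp
  also have "\<dots> = (1 - t) * ((norm ?x)\<^sup>2 - (t * ?D)\<^sup>2)"
    by (simp add: power2_eq_square algebra_simps)
  also have "\<dots> \<le> 0"
    using \<open>(norm ?x)\<^sup>2 \<le> (t * ?D)\<^sup>2\<close> t by (intro mult_nonneg_nonpos) auto
  finally have "?x = t *\<^sub>R ?z"
    by simp
  then show ?thesis
    by (simp add: algebra_simps)
qed

text \<open>Zorn's lemma: two points of the union of a chain already lie in a common member, so the
  union preserves distances.\<close>

lemma preserves_distances_on_subset_leaf: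
  assumes S: "preserves_distances_on S u"
  obtains T where "leaf u T" "S \<subseteq> T"
proof -
  let ?A = "{T. S \<subseteq> T \<and> preserves_distances_on T u}"
  have "\<exists>M\<in>?A. \<forall>X\<in>?A. M \<subseteq> X \<longrightarrow> X = M"
  proof (rule subset_Zorn_nonempty)
    show "?A \<noteq> {}" using S by blast
    fix C assume C: "C \<noteq> {}" "subset.chain ?A C"
    have "dist (u x) (u y) = dist x y" if xy: "x \<in> \<Union>C" "y \<in> \<Union>C" for x y
    proof -
      from xy obtain X Y where "X \<in> C" "x \<in> X" "Y \<in> C" "y \<in> Y" by blast
      moreover from this have "X \<subseteq> Y \<or> Y \<subseteq> X"
        using C(2) by (auto simp: subset_chain_def)
      ultimately obtain Z where "Z \<in> C" "x \<in> Z" "y \<in> Z" by blast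
      then show ?thesis
        using C(2) by (auto simp: subset_chain_def preserves_distances_on_def)
    qed
    moreover have "S \<subseteq> \<Union>C"
      using C by (fastforce simp: subset_chain_def)
    ultimately show "\<Union>C \<in> ?A"
      by (simp add: preserves_distances_on_def)
  qed
  then obtain M where M: "M \<in> ?A" "\<forall>X\<in>?A. M \<subseteq> X \<longrightarrow> X = M" ..
  have "X = M" if "M \<subseteq> X" "preserves_distances_on X u" for X
    using M that by auto
  then have "leaf u M"
    using M(1) by (simp add: leaf_def)
  then show ?thesis
    using M(1) by (intro that[of M]) auto
qed

lemma preserves_distances_on_pair:
  "dist (u x) (u y) = dist x y \<Longrightarrow> preserves_distances_on {x, y} u"
  by (auto simp: preserves_distances_on_def dist_commute)

text \<open>A point outside the branching set lies on at most one leaf, so isometric pairs can be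
  composed there: the leaves through \<open>x\<close>, \<open>y\<close> and through
  \<open>y\<close>, \<open>z\<close> coincide. The set is Borel because projecting a closed set
  along the compact \<open>K\<close> gives a closed set.\<close>

lemma transport_set_saturation:
  fixes u :: "'a::euclidean_space \<Rightarrow> 'b::metric_space"
  assumes u: "continuous_on UNIV u" and K: "compact K"
  shows "transport_set u {y. \<exists>x\<in>K. dist (u x) (u y) = dist x y}" (is "transport_set u ?A")
  unfolding transport_set_def
proof (intro conjI ballI allI impI)
  have [continuous_intros]: "continuous_on UNIV (\<lambda>z::'a\<times>'a. u (fst z))" "continuous_on UNIV (\<lambda>z::'a\<times>'a. u (snd z))"
    by (auto intro!: continuous_on_compose2[OF u] continuous_intros)
  have "closed {z :: 'a \<times> 'a. dist (u (fst z)) (u (snd z)) = dist (fst z) (snd z)}"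
    by (intro closed_Collect_eq continuous_intros)
  from closed_compact_projection[OF K this] show "?A \<in> sets borel"
    by (simp add: Bex_def borel_closed)
next
  fix y z assume y: "y \<in> ?A - branching_set u" and yz: "dist (u y) (u z) = dist y z"
  then obtain x where x: "x \<in> K" "dist (u x) (u y) = dist x y" by blast
  obtain S where S: "leaf u S" "{x, y} \<subseteq> S"
    using preserves_distances_on_subset_leaf[OF preserves_distances_on_pair[OF x(2)]] .
  obtain T where T: "leaf u T" "{y, z} \<subseteq> T"
    using preserves_distances_on_subset_leaf[OF preserves_distances_on_pair[OF yz]] .
  have "S = T"
    using y S T by (auto simp: branching_set_def)
  then have "dist (u x) (u z) = dist x z"
    using S T by (auto simp: leaf_def preserves_distances_on_def)
  then show "z \<in> ?A"
    using x(1) by blast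
qed

section \<open>Winding around a circle\<close>

text \<open>If equality held, the double angle formula and the weak inequality at
  \<open>x / 2\<close> would force \<open>\<bar>cos (x / 2)\<bar> = 1\<close>, hence
  \<open>sin x = 0\<close>. The strictness makes chords of the circle shorter than arcs.\<close>

lemma abs_sin_less_abs:
  fixes x :: real
  assumes "x \<noteq> 0"
  shows "\<bar>sin x\<bar> < \<bar>x\<bar>"
proof (rule ccontr)
  assume "\<not> \<bar>sin x\<bar> < \<bar>x\<bar>"
  then have eq: "\<bar>sin x\<bar> = \<bar>x\<bar>" using abs_sin_x_le_abs_x[of x] by linarith
  have "\<bar>x\<bar> = 2 * \<bar>sin (x / 2)\<bar> * \<bar>cos (x / 2)\<bar>"
    using eq sin_double[of "x / 2"] by (simp add: abs_mult)
  also have "\<dots> \<le> \<bar>x\<bar> * \<bar>cos (x / 2)\<bar>"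
    using abs_sin_x_le_abs_x[of "x / 2"] by (intro mult_right_mono) auto
  finally have "1 \<le> \<bar>cos (x / 2)\<bar>"
    using assms by simp
  then have "(cos (x / 2))\<^sup>2 = 1"
    using abs_cos_le_one[of "x / 2"] by (simp add: abs_square_eq_1)
  then have "sin (x / 2) = 0"
    using sin_cos_squared_add[of "x / 2"] by simp
  then show False
    using eq assms sin_double[of "x / 2"] by simp
qed

lemma norm_scaleR_add_power2:
  fixes x y :: "'a::real_inner"
  shows "(norm (r *\<^sub>R x + y))\<^sup>2 = r\<^sup>2 * (norm x)\<^sup>2 + 2 * r * (x \<bullet> y) + (norm y)\<^sup>2"
  unfolding power2_norm_eq_inner
  by (simp add: inner_add_left inner_add_right inner_commute power2_eq_square algebra_simps)

lemma norm_diff_power2_le: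
  fixes x y :: "'a::real_inner"
  shows "(norm (x - y))\<^sup>2 \<le> 2 * (norm (x - z))\<^sup>2 + 2 * (norm (y - z))\<^sup>2"
proof -
  have "2 * (norm (x - z))\<^sup>2 + 2 * (norm (y - z))\<^sup>2 - (norm (x - y))\<^sup>2 = (norm ((x - z) + (y - z)))\<^sup>2"
    by (simp add: power2_norm_eq_inner inner_add_left inner_add_right inner_diff_left inner_diff_right
        inner_commute algebra_simps)
  then show ?thesis
    using zero_le_power2[of "norm ((x - z) + (y - z))"] by linarith
qed

locale circle_strip =
  fixes e :: "'a::euclidean_space" and a b :: "'b::euclidean_space"
  assumes e: "e \<in> Basis" and a: "a \<in> Basis" and b: "b \<in> Basis" and ab: "a \<noteq> b"
begin

definition g :: "real \<Rightarrow> 'b" where "g t = cos t *\<^sub>R a + sin t *\<^sub>R b"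
text \<open>\<open>One\<close> has all coordinates 1, so the box has length pi along
  \<open>e\<close> and length 1 in the other directions. The sine vanishes at 0 and at pi, so
  \<open>H\<close> has no jump along lines parallel to \<open>e\<close>.\<close>

definition U :: "'a set" where "U = box 0 (One + (pi - 1) *\<^sub>R e)"
text \<open>On \<open>U\<close> this is the derivative of \<open>H\<close> along \<open>e\<close>,
  since cos t g(t) + sin t g'(t) = g(2t).\<close>

definition f :: "'a \<Rightarrow> 'b" where "f x = indicator U x *\<^sub>R g (2 * (x \<bullet> e))"
definition h :: "'a \<Rightarrow> real" where "h x = indicator U x * sin (x \<bullet> e)"
definition H :: "'a \<Rightarrow> 'b" where "H x = h x *\<^sub>R g (x \<bullet> e)"
definition u :: "'a \<Rightarrow> 'b" where "u x = g (x \<bullet> e + pi / 2)"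
text \<open>The error of the backward difference quotient of \<open>H\<close> as an approximation of
  \<open>f\<close>. Backward quotients of \<open>H\<close> become forward increments of the test map
  after a translation.\<close>

definition q :: "real \<Rightarrow> 'a \<Rightarrow> 'b" where "q \<epsilon> x = f x - (H x - H (x - \<epsilon> *\<^sub>R e)) /\<^sub>R \<epsilon>"

lemma basis_inner [simp]: "a \<bullet> a = 1" "b \<bullet> b = 1" "a \<bullet> b = 0" "b \<bullet> a = 0" "e \<bullet> e = 1"
  using a b ab e by (auto simp: inner_Basis)

lemma inner_g: "g s \<bullet> g t = cos (s - t)"
  by (simp add: g_def inner_add_left inner_add_right cos_diff)

lemma norm_g [simp]: "norm (g t) = 1"
  by (simp add: norm_eq_sqrt_inner inner_g)

lemma norm_g_diff: "norm (g s - g t) = 2 * \<bar>sin ((s - t) / 2)\<bar>"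
proof -
  define d where "d = (s - t) / 2"
  have d: "s - t = 2 * d" by (simp add: d_def)
  have "(norm (g s - g t))\<^sup>2 = 2 - 2 * cos (s - t)"
    by (simp add: power2_norm_eq_inner inner_diff_left inner_diff_right inner_g cos_diff mult.commute)
  also have "\<dots> = (2 * \<bar>sin ((s - t) / 2)\<bar>)\<^sup>2"
    unfolding d by (simp add: cos_double_sin power_mult_distrib)
  finally show ?thesis
    by (rule power2_eq_imp_eq) auto
qed

lemma norm_g_diff_le: "norm (g s - g t) \<le> \<bar>s - t\<bar>"
  using abs_sin_x_le_abs_x[of "(s - t) / 2"] by (simp add: norm_g_diff)

lemma norm_g_diff_less: "s \<noteq> t \<Longrightarrow> norm (g s - g t) < \<bar>s - t\<bar>"
  using abs_sin_less_abs[of "(s - t) / 2"] by (simp add: norm_g_diff)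

text \<open>The curve \<open>sin t *\<^sub>R g t\<close> is a circle of radius 1/2 traversed at unit
  speed, so its chords have a closed form. This makes the difference quotients of \<open>H\<close>
  inside \<open>U\<close> explicit.\<close>

lemma sin_g_diff: "sin t *\<^sub>R g t - sin s *\<^sub>R g s = sin (t - s) *\<^sub>R g (t + s)"
proof -
  have t: "(cos t)\<^sup>2 + (sin t)\<^sup>2 = 1" and s: "(cos s)\<^sup>2 + (sin s)\<^sup>2 = 1"
    by simp_all
  have "sin (t - s) * cos (t + s) = sin t * cos t - sin s * cos s"
    unfolding sin_diff cos_add using t s by algebra
  moreover have "sin (t - s) * sin (t + s) = sin t * sin t - sin s * sin s"
    unfolding sin_diff sin_add using t s by algebra
  ultimately show ?thesis
    by (simp add: g_def scaleR_add_right algebra_simps flip: scaleR_add_left scaleR_diff_left)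
qed

lemma continuous_on_g [continuous_intros]:
  fixes k :: "'c::t2_space \<Rightarrow> real"
  shows "continuous_on S k \<Longrightarrow> continuous_on S (\<lambda>x. g (k x))"
  unfolding g_def by (intro continuous_intros)

lemma isCont_g: "isCont g t"
  using continuous_on_g[of UNIV "\<lambda>x. x"] by (simp add: continuous_on_eq_continuous_at continuous_on_id)

lemma mem_U: "x \<in> U \<longleftrightarrow> 0 < x \<bullet> e \<and> x \<bullet> e < pi \<and> (\<forall>i\<in>Basis - {e}. 0 < x \<bullet> i \<and> x \<bullet> i < 1)"
proof -
  have "(One + (pi - 1) *\<^sub>R e) \<bullet> i = (if i = e then pi else 1)" if "i \<in> Basis" for i
    using that e by (auto simp: inner_add_left inner_Basis)
  then show ?thesis
    using e by (auto simp: U_def mem_box)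
qed

lemma inner_translate: "(x + c *\<^sub>R e) \<bullet> e = x \<bullet> e + c" "(x - c *\<^sub>R e) \<bullet> e = x \<bullet> e - c"
  "i \<in> Basis - {e} \<Longrightarrow> (x + c *\<^sub>R e) \<bullet> i = x \<bullet> i" "i \<in> Basis - {e} \<Longrightarrow> (x - c *\<^sub>R e) \<bullet> i = x \<bullet> i"
  using e by (auto simp: inner_add_left inner_diff_left inner_Basis)

lemma open_U: "open U" by (simp add: U_def open_box)

lemma measurable_strip [measurable]: "U \<in> sets borel" "g \<in> borel_measurable borel" "f \<in> borel_measurable borel"
  "h \<in> borel_measurable borel" "H \<in> borel_measurable borel" "q \<epsilon> \<in> borel_measurable borel"
proof -
  show [measurable]: "U \<in> sets borel" using open_U by simp
  show [measurable]: "g \<in> borel_measurable borel"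
    by (intro borel_measurable_continuous_onI continuous_intros)
  show [measurable]: "f \<in> borel_measurable borel" unfolding f_def by measurable
  show [measurable]: "h \<in> borel_measurable borel" unfolding h_def by measurable
  show [measurable]: "H \<in> borel_measurable borel" unfolding H_def by measurable
  show "q \<epsilon> \<in> borel_measurable borel" unfolding q_def by measurable
qed

text \<open>One compact box containing \<open>U\<close> and its translates by
  \<open>\<epsilon> *\<^sub>R e\<close> for \<epsilon> between 0 and pi, so that the majorants below
  do not depend on \<epsilon>.\<close>

definition B :: "'a set" where "B = cbox 0 (One + (2 * pi) *\<^sub>R e)"

lemma mem_B: "x \<in> B \<longleftrightarrow> 0 \<le> x \<bullet> e \<and> x \<bullet> e \<le> 1 + 2 * pi \<and> (\<forall>i\<in>Basis - {e}. 0 \<le> x \<bullet> i \<and> x \<bullet> i \<le> 1)"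
proof -
  have "(One + (2 * pi) *\<^sub>R e) \<bullet> i = (if i = e then 1 + 2 * pi else 1)" if "i \<in> Basis" for i
    using that e by (auto simp: inner_add_left inner_Basis)
  then show ?thesis
    using e by (auto simp: B_def mem_box)
qed

lemma translate_U_subset_B: "x - \<epsilon> *\<^sub>R e \<in> U \<Longrightarrow> 0 \<le> \<epsilon> \<Longrightarrow> \<epsilon> \<le> pi \<Longrightarrow> x \<in> B"
  by (auto simp: mem_U mem_B inner_translate less_imp_le)

lemma U_subset_B: "U \<subseteq> B"
  using translate_U_subset_B[of _ 0] by auto

lemma h_nonneg: "0 \<le> h x"
  by (auto simp: h_def mem_U indicator_def intro: sin_ge_zero)

lemma norm_H: "norm (H x) = h x"
  using h_nonneg by (simp add: H_def)

lemma norm_strip_le: "norm (f x) \<le> 1 * indicator B x" "norm (H x) \<le> 1 * indicator B x"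
  using U_subset_B by (auto simp: f_def h_def H_def split: split_indicator)

lemma norm_H_translate_le:
  "0 \<le> \<epsilon> \<Longrightarrow> \<epsilon> \<le> pi \<Longrightarrow> norm (H (x - \<epsilon> *\<^sub>R e)) \<le> 1 * indicator B x"
  using translate_U_subset_B[of x \<epsilon>] by (auto simp: h_def H_def split: split_indicator)

section \<open>Difference quotients of \<open>H\<close>\<close>

text \<open>A majorant uniform in \<epsilon>, for dominated convergence. With both points in
  \<open>U\<close> the chord formula bounds the increment by \<epsilon>; if just one lies in
  \<open>U\<close>, its distance to the face crossed is at most \<epsilon>, and so is the sine
  there.\<close>

lemma norm_q_le:
  assumes "0 < \<epsilon>" "\<epsilon> \<le> pi"
  shows "norm (q \<epsilon> x) \<le> 2 * indicator B x"
proof -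
  let ?y = "x - \<epsilon> *\<^sub>R e" and ?t = "x \<bullet> e"
  have "norm (H x - H ?y) \<le> \<epsilon> * indicator B x"
  proof (cases "x \<in> U")
    case True
    then have B: "x \<in> B" using U_subset_B by auto
    show ?thesis
    proof (cases "?y \<in> U")
      case True
      have "H x - H ?y = sin \<epsilon> *\<^sub>R g (2 * ?t - \<epsilon>)"
        using \<open>x \<in> U\<close> True sin_g_diff[of ?t "?t - \<epsilon>"] by (simp add: H_def h_def inner_translate algebra_simps)
      then show ?thesis
        using B abs_sin_x_le_abs_x[of \<epsilon>] assms by simp
    next
      case False
      then have "?t \<le> \<epsilon>" "0 \<le> ?t"
        using \<open>x \<in> U\<close> assms by (force simp: mem_U inner_translate)+
      then show ?thesis
        using B False \<open>x \<in> U\<close> abs_sin_x_le_abs_x[of ?t] by (simp add: H_def h_def)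
    qed
  next
    case False
    show ?thesis
    proof (cases "?y \<in> U")
      case True
      then have B: "x \<in> B" using translate_U_subset_B[of x \<epsilon>] assms by simp
      have "pi - (?t - \<epsilon>) \<le> \<epsilon>" "0 \<le> pi - (?t - \<epsilon>)"
        using True False assms by (force simp: mem_U inner_translate)+
      then have "\<bar>sin (?t - \<epsilon>)\<bar> \<le> \<epsilon>"
        using abs_sin_x_le_abs_x[of "pi - (?t - \<epsilon>)"] by (simp add: sin_diff)
      then show ?thesis
        using B False True by (simp add: H_def h_def inner_translate)
    next
      case False
      then show ?thesis
        using \<open>x \<notin> U\<close> assms by (simp add: H_def h_def)
    qed
  qed
  then have "norm (H x - H ?y) / \<epsilon> \<le> indicator B x"
    using assms by (simp add: pos_divide_le_eq mult.commute)
  then have "norm ((H x - H ?y) /\<^sub>R \<epsilon>) \<le> indicator B x"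
    using assms by (simp add: divide_inverse mult.commute)
  then show ?thesis
    using norm_strip_le(1)[of x] norm_triangle_ineq4[of "f x" "(H x - H ?y) /\<^sub>R \<epsilon>"] by (simp add: q_def)
qed

lemma integrable_f: "integrable lborel f"
proof (rule Bochner_Integration.integrable_bound)
  show "integrable lborel (\<lambda>x. indicator B x :: real)"
    by (auto intro!: integrable_real_indicator simp: emeasure_lborel_cbox_finite[unfolded infinity_ennreal_def] B_def)
qed (use norm_strip_le(1) in auto)

lemma integrable_H: "integrable lborel H"
proof (rule Bochner_Integration.integrable_bound)
  show "integrable lborel (\<lambda>x. indicator B x :: real)"
    by (auto intro!: integrable_real_indicator simp: emeasure_lborel_cbox_finite[unfolded infinity_ennreal_def] B_def)
qed (use norm_strip_le(2) in auto)

lemma integrable_h: "integrable lborel h"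
  using integrable_norm[OF integrable_H] by (simp add: norm_H)

text \<open>For a point of \<open>U\<close> the translate eventually stays in \<open>U\<close>, and
  \<open>sin (\<epsilon> k) / \<epsilon> k\<close> tends to 1. In the relative interior of the face
  \<open>x \<bullet> e = pi\<close> the quotient keeps a nonzero limit, hence the almost everywhere
  form.\<close>

lemma tendsto_q:
  assumes \<epsilon>: "\<And>k. 0 < \<epsilon> k" "\<epsilon> \<longlonglongrightarrow> 0"
  shows "AE x in lborel. (\<lambda>k. q (\<epsilon> k) x) \<longlonglongrightarrow> 0"
proof -
  have lim_q: "(\<lambda>k. q (\<epsilon> k) x) \<longlonglongrightarrow> 0" if x: "x \<bullet> e \<noteq> 0" "x \<bullet> e \<noteq> pi" for x
  proof -
    let ?t = "x \<bullet> e"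
    have lim: "(\<lambda>k. ?t - \<epsilon> k) \<longlonglongrightarrow> ?t"
      using tendsto_diff[OF tendsto_const \<epsilon>(2), of ?t] by simp
    show ?thesis
    proof (cases "x \<in> U")
      case True
      then have "0 < ?t" by (simp add: mem_U)
      have "(\<lambda>k. g (2 * ?t) - (sin (\<epsilon> k) / \<epsilon> k) *\<^sub>R g (2 * ?t - \<epsilon> k)) \<longlonglongrightarrow> g (2 * ?t) - 1 *\<^sub>R g (2 * ?t - 0)"
      proof (intro tendsto_intros isCont_tendsto_compose[OF isCont_g] \<epsilon>(2))
        have "((\<lambda>x. sin x / x :: real) \<longlongrightarrow> 1) (at 0)"
          using DERIV_sin[of "0::real"] by (simp add: DERIV_def)
        moreover have "filterlim \<epsilon> (at 0) sequentially"
          using \<epsilon> by (auto simp: filterlim_at less_imp_neq[THEN not_sym] less_imp_neq)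
        ultimately show "(\<lambda>k. sin (\<epsilon> k) / \<epsilon> k) \<longlonglongrightarrow> 1"
          by (rule filterlim_compose)
      qed
      moreover have "\<forall>\<^sub>F k in sequentially. g (2 * ?t) - (sin (\<epsilon> k) / \<epsilon> k) *\<^sub>R g (2 * ?t - \<epsilon> k) = q (\<epsilon> k) x"
        using order_tendstoD(1)[OF lim \<open>0 < ?t\<close>]
      proof eventually_elim
        case (elim k)
        then have "x - \<epsilon> k *\<^sub>R e \<in> U"
          using True \<epsilon>(1)[of k] by (auto simp: mem_U inner_translate)
        then have "H x - H (x - \<epsilon> k *\<^sub>R e) = sin (\<epsilon> k) *\<^sub>R g (2 * ?t - \<epsilon> k)"
          using True sin_g_diff[of ?t "?t - \<epsilon> k"] by (simp add: H_def h_def inner_translate algebra_simps)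
        then show ?case
          using True by (simp add: q_def f_def divide_inverse_commute)
      qed
      ultimately show ?thesis
        by (simp add: Lim_transform_eventually)
    next
      case False
      have "\<forall>\<^sub>F k in sequentially. x - \<epsilon> k *\<^sub>R e \<notin> U"
      proof (cases "?t > pi")
        case True
        show ?thesis
          using order_tendstoD(1)[OF lim True] by eventually_elim (auto simp: mem_U inner_translate)
      next
        case False
        \<comment> \<open>Here \<open>x \<bullet> e < 0\<close> or another coordinate lies outside
          the open unit interval; both persist under backward translation.\<close>
        then have "x - \<epsilon> k *\<^sub>R e \<notin> U" for k
          using \<open>x \<notin> U\<close> x \<epsilon>(1)[of k] by (auto simp: mem_U inner_translate)
        then show ?thesis by simp
      qed
      then have "\<forall>\<^sub>F k in sequentially. 0 = q (\<epsilon> k) x"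
        by eventually_elim (use False in \<open>simp add: q_def f_def H_def h_def\<close>)
      then show ?thesis
        by (rule Lim_transform_eventually[OF tendsto_const])
    qed
  qed
  show ?thesis
    using AE_lborel_inner_neq[OF e, of 0] AE_lborel_inner_neq[OF e, of pi]
    by eventually_elim (rule lim_q)
qed

lemma tendsto_integral_norm_q:
  assumes \<phi>: "continuous_on UNIV \<phi>" and \<epsilon>: "\<And>k. 0 < \<epsilon> k" "\<And>k. \<epsilon> k \<le> pi" "\<epsilon> \<longlonglongrightarrow> 0"
  shows "(\<lambda>k. LINT x|lborel. \<phi> x * norm (q (\<epsilon> k) x)) \<longlonglongrightarrow> 0"
proof -
  have "(\<lambda>k. LINT x|lborel. \<phi> x * norm (q (\<epsilon> k) x)) \<longlonglongrightarrow> (LINT x|(lborel :: 'a measure). (0::real))"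
  proof (rule integral_dominated_convergence[where w = "\<lambda>x. \<bar>\<phi> x\<bar> * norm (2 * indicator B x :: real)"])
    have [measurable]: "\<phi> \<in> borel_measurable borel"
      by (rule borel_measurable_continuous_onI[OF \<phi>])
    show "(\<lambda>x. \<phi> x * norm (q (\<epsilon> k) x)) \<in> borel_measurable lborel" for k by measurable
    show "integrable lborel (\<lambda>x. \<bar>\<phi> x\<bar> * norm (2 * indicator B x :: real))"
      by (rule integrable_norm_compact_support[where C = 2 and l = 0 and r = "One + (2 * pi) *\<^sub>R e"])
        (use \<phi> in \<open>auto intro!: continuous_intros simp: B_def\<close>)
    show "AE x in lborel. (\<lambda>k. \<phi> x * norm (q (\<epsilon> k) x)) \<longlonglongrightarrow> 0"
      using tendsto_q[OF \<epsilon>(1,3)] by eventually_elim (auto intro!: tendsto_mult_right_zero tendsto_norm_zero)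
    show "AE x in lborel. norm (\<phi> x * norm (q (\<epsilon> k) x)) \<le> \<bar>\<phi> x\<bar> * norm (2 * indicator B x :: real)" for k
      using norm_q_le[OF \<epsilon>(1,2)] by (auto simp: abs_mult intro!: AE_I2 mult_left_mono)
  qed simp_all
  then show ?thesis by simp
qed

lemma integrable_inner:
  assumes "continuous_on UNIV v" "F \<in> borel_measurable borel" "\<And>x. norm (F x) \<le> C * indicator B x"
  shows "integrable lborel (\<lambda>x. v x \<bullet> (F x :: 'b))"
  using integrable_inner_compact_support[of v F C 0 "One + (2 * pi) *\<^sub>R e"] assms by (simp add: B_def)

lemma integrable_mult_norm:
  fixes \<phi> :: "'a \<Rightarrow> real" and F :: "'a \<Rightarrow> 'b"
  assumes "continuous_on UNIV \<phi>" "F \<in> borel_measurable borel" "\<And>x. norm (F x) \<le> C * indicator B x"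
  shows "integrable lborel (\<lambda>x. \<phi> x * norm (F x))"
  using integrable_norm_compact_support[of \<phi> F C 0 "One + (2 * pi) *\<^sub>R e"] assms by (simp add: B_def)

section \<open>Integration by parts at scale \<epsilon>\<close>

text \<open>A finite-difference version of minus the integral of the derivative of \<open>v\<close>
  along \<open>e\<close> against \<open>H\<close>, which makes sense for every continuous
  \<open>v\<close>.\<close>

definition J :: "real \<Rightarrow> ('a \<Rightarrow> 'b) \<Rightarrow> real" where
  "J \<epsilon> v = (LINT x|lborel. (v x - v (x + \<epsilon> *\<^sub>R e)) \<bullet> H x) / \<epsilon>"

lemma integrable_J:
  assumes "continuous_on UNIV v"
  shows "integrable lborel (\<lambda>x. (v x - v (x + \<epsilon> *\<^sub>R e)) \<bullet> H x)"
proof (rule integrable_inner[where C = 1])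
  show "continuous_on UNIV (\<lambda>x. v x - v (x + \<epsilon> *\<^sub>R e))"
    by (intro continuous_intros continuous_on_compose2[OF assms] assms) auto
qed (use norm_strip_le in auto)

text \<open>Translation invariance moves the difference quotient from \<open>H\<close> to
  \<open>v\<close>; what is left of \<open>f\<close> is \<open>q \<epsilon>\<close>.\<close>

lemma integral_inner_f:
  assumes v: "continuous_on UNIV v" and \<epsilon>: "0 < \<epsilon>" "\<epsilon> \<le> pi"
  shows "(LINT x|lborel. v x \<bullet> f x) = J \<epsilon> v + (LINT x|lborel. v x \<bullet> q \<epsilon> x)"
proof -
  have [measurable]: "v \<in> borel_measurable borel"
    by (rule borel_measurable_continuous_onI[OF v])
  have int: "integrable lborel (\<lambda>x. v x \<bullet> f x)" "integrable lborel (\<lambda>x. v x \<bullet> H x)"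
    "integrable lborel (\<lambda>x. v x \<bullet> H (x - \<epsilon> *\<^sub>R e))" "integrable lborel (\<lambda>x. v (x + \<epsilon> *\<^sub>R e) \<bullet> H x)"
    using norm_strip_le norm_H_translate_le[of \<epsilon>] \<epsilon>
    by (auto intro!: integrable_inner[where C = 1] v continuous_on_compose2[OF v] continuous_intros)
  have "(LINT x|lborel. v (x + \<epsilon> *\<^sub>R e) \<bullet> H x) = (LINT x|lborel. v x \<bullet> H (x - \<epsilon> *\<^sub>R e))"
    using lborel_integral_translate[of "\<lambda>x. v x \<bullet> H (x - \<epsilon> *\<^sub>R e)" "\<epsilon> *\<^sub>R e"] by simp
  moreover have "(\<lambda>x. v x \<bullet> q \<epsilon> x) = (\<lambda>x. v x \<bullet> f x - (v x \<bullet> H x - v x \<bullet> H (x - \<epsilon> *\<^sub>R e)) / \<epsilon>)"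
    by (simp add: q_def inner_diff_right divide_inverse mult.commute fun_eq_iff)
  ultimately show ?thesis
    using int by (simp add: J_def inner_diff_left diff_divide_distrib)
qed

lemma tendsto_J:
  assumes v: "continuous_on UNIV v" and \<epsilon>: "\<And>k. 0 < \<epsilon> k" "\<And>k. \<epsilon> k \<le> pi" "\<epsilon> \<longlonglongrightarrow> 0"
  shows "(\<lambda>k. J (\<epsilon> k) v) \<longlonglongrightarrow> (LINT x|lborel. v x \<bullet> f x)"
proof -
  have "(\<lambda>k. LINT x|lborel. v x \<bullet> q (\<epsilon> k) x) \<longlonglongrightarrow> 0"
  proof (rule Lim_null_comparison)
    show "(\<lambda>k. LINT x|lborel. norm (v x) * norm (q (\<epsilon> k) x)) \<longlonglongrightarrow> 0"
      using v by (intro tendsto_integral_norm_q[OF _ \<epsilon>] continuous_intros)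
    have "norm (LINT x|lborel. v x \<bullet> q (\<epsilon> k) x) \<le> (LINT x|lborel. norm (v x) * norm (q (\<epsilon> k) x))" for k
    proof (rule order_trans[OF integral_norm_bound integral_mono])
      show "integrable lborel (\<lambda>x. norm (v x \<bullet> q (\<epsilon> k) x))"
        using norm_q_le[OF \<epsilon>(1,2)] v by (intro integrable_norm integrable_inner) auto
      show "integrable lborel (\<lambda>x. norm (v x) * norm (q (\<epsilon> k) x))"
        using norm_q_le[OF \<epsilon>(1,2)] v by (intro integrable_mult_norm continuous_intros) auto
    qed (simp add: Cauchy_Schwarz_ineq2)
    then show "\<forall>\<^sub>F k in sequentially. norm (LINT x|lborel. v x \<bullet> q (\<epsilon> k) x)
        \<le> (LINT x|lborel. norm (v x) * norm (q (\<epsilon> k) x))"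
      by simp
  qed
  note tendsto_diff[OF tendsto_const this, of "LINT x|lborel. v x \<bullet> f x"]
  moreover have "J (\<epsilon> k) v = (LINT x|lborel. v x \<bullet> f x) - (LINT x|lborel. v x \<bullet> q (\<epsilon> k) x)" for k
    using integral_inner_f[OF v \<epsilon>(1,2), of k] by simp
  ultimately show ?thesis
    by simp
qed

definition \<epsilon>\<^sub>0 :: "nat \<Rightarrow> real" where "\<epsilon>\<^sub>0 k = 1 / real (Suc k)"

lemma \<epsilon>\<^sub>0: "0 < \<epsilon>\<^sub>0 k" "\<epsilon>\<^sub>0 k \<le> pi" "\<epsilon>\<^sub>0 \<longlonglongrightarrow> 0"
proof -
  show "\<epsilon>\<^sub>0 k \<le> pi"
    using pi_gt3 by (intro order_trans[of "\<epsilon>\<^sub>0 k" 1 pi]) (simp_all add: \<epsilon>\<^sub>0_def)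
qed (use LIMSEQ_inverse_real_of_nat in \<open>simp_all add: \<epsilon>\<^sub>0_def[abs_def] divide_inverse\<close>)

lemma J_le:
  assumes v: "1-lipschitz_on UNIV v" and \<epsilon>: "0 < \<epsilon>"
  shows "J \<epsilon> v \<le> (LINT x|lborel. h x)"
proof -
  have "(LINT x|lborel. (v x - v (x + \<epsilon> *\<^sub>R e)) \<bullet> H x) \<le> (LINT x|lborel. \<epsilon> * h x)"
  proof (rule integral_mono[OF integrable_J])
    show "continuous_on UNIV v" using v by (rule lipschitz_on_continuous_on)
    fix x
    have "(v x - v (x + \<epsilon> *\<^sub>R e)) \<bullet> H x \<le> norm (v x - v (x + \<epsilon> *\<^sub>R e)) * norm (H x)"
      by (rule norm_cauchy_schwarz)
    also have "\<dots> \<le> \<epsilon> * h x"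
      using lipschitz_on_1_norm_diff[OF v, of x "x + \<epsilon> *\<^sub>R e"] \<epsilon> e h_nonneg[of x]
      by (simp add: norm_H mult_right_mono)
    finally show "(v x - v (x + \<epsilon> *\<^sub>R e)) \<bullet> H x \<le> \<epsilon> * h x" .
  qed (intro integrable_mult_right integrable_h)
  then show ?thesis
    using \<epsilon> by (simp add: J_def pos_divide_le_eq mult.commute)
qed

lemma integral_inner_f_le:
  assumes v: "1-lipschitz_on UNIV v"
  shows "(LINT x|lborel. v x \<bullet> f x) \<le> (LINT x|lborel. h x)"
proof (rule LIMSEQ_le_const2[OF tendsto_J])
  show "continuous_on UNIV v" using v by (rule lipschitz_on_continuous_on)
qed (use \<epsilon>\<^sub>0 J_le[OF v] in auto)

section \<open>Optimal potentials\<close>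

lemma lipschitz_u: "1-lipschitz_on UNIV u"
proof (rule lipschitz_onI)
  fix x y
  have "norm (u x - u y) \<le> \<bar>(x - y) \<bullet> e\<bar>"
    using norm_g_diff_le[of "x \<bullet> e + pi / 2" "y \<bullet> e + pi / 2"] by (simp add: u_def inner_diff_left)
  also have "\<dots> \<le> norm (x - y)"
    using e by (rule Basis_le_norm)
  finally show "dist (u x) (u y) \<le> 1 * dist x y"
    by (simp add: dist_norm)
qed simp

text \<open>\<open>u\<close> depends on \<open>x \<bullet> e\<close> alone and replaces arcs of the
  circle by chords, which are strictly shorter; for two points on a common level the left side is
  0.\<close>

lemma u_dist_less: "x \<noteq> y \<Longrightarrow> norm (u x - u y) < norm (x - y)"
proof (cases "x \<bullet> e = y \<bullet> e")
  case False
  then have "norm (u x - u y) < \<bar>(x - y) \<bullet> e\<bar>"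
    using norm_g_diff_less[of "x \<bullet> e + pi / 2" "y \<bullet> e + pi / 2"] by (simp add: u_def inner_diff_left)
  then show ?thesis
    using Basis_le_norm[OF e, of "x - y"] by simp
qed (simp add: u_def)

text \<open>The two angles differ by pi/2 minus \<open>x \<bullet> e\<close>. Consequently
  \<open>u\<close> attains the bound of \<open>integral_inner_f_le\<close>.\<close>

lemma u_inner_f: "u x \<bullet> f x = h x"
proof -
  have "cos (x \<bullet> e + pi / 2 - 2 * (x \<bullet> e)) = sin (x \<bullet> e)"
    by (simp add: cos_add cos_diff sin_double cos_double)
  then show ?thesis
    by (simp add: u_def f_def h_def inner_g)
qed

definition \<mu> :: "'a set \<Rightarrow> 'b" where "\<mu> = pushforward lborel (\<lambda>x. x) f"

text \<open>Since \<open>u\<close> attains the upper bound, the supremum is the integral of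
  \<open>h\<close>, and optimality reduces to one equation.\<close>

lemma optimal_potential_iff:
  "optimal_potential \<mu> v \<longleftrightarrow> 1-lipschitz_on UNIV v \<and> (LINT x|lborel. v x \<bullet> f x) = (LINT x|lborel. h x)"
proof -
  have vi: "vector_integral \<mu> v = (LINT x|lborel. v x \<bullet> f x)" if "1-lipschitz_on UNIV v" for v
  proof -
    have v: "continuous_on UNIV v" using that by (rule lipschitz_on_continuous_on)
    then have "v \<in> borel_measurable borel"
      by (rule borel_measurable_continuous_onI)
    then show ?thesis
      unfolding \<mu>_def using v norm_strip_le(1)
      by (intro vector_integral_pushforward integrable_f
        integrable_mult_norm[where C = 1] continuous_intros) auto
  qed
  have opt: "optimal_potential \<mu> v \<longleftrightarrow> 1-lipschitz_on UNIV v \<and>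
      (\<forall>w. 1-lipschitz_on UNIV w \<longrightarrow> (LINT x|lborel. w x \<bullet> f x) \<le> (LINT x|lborel. v x \<bullet> f x))"
    by (auto simp: optimal_potential_def vi)
  have u: "(LINT x|lborel. u x \<bullet> f x) = (LINT x|lborel. h x)"
    by (simp add: u_inner_f)
  show ?thesis
    unfolding opt
  proof (intro iffI conjI; (elim conjE)?)
    assume v: "1-lipschitz_on UNIV v"
      "\<forall>w. 1-lipschitz_on UNIV w \<longrightarrow> (LINT x|lborel. w x \<bullet> f x) \<le> (LINT x|lborel. v x \<bullet> f x)"
    show "(LINT x|lborel. v x \<bullet> f x) = (LINT x|lborel. h x)"
      using v(2)[rule_format, OF lipschitz_u] integral_inner_f_le[OF v(1)] u by linarith
  qed (use integral_inner_f_le in auto)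
qed

lemma optimal_potential_u: "optimal_potential \<mu> u"
  by (simp add: optimal_potential_iff lipschitz_u u_inner_f)

section \<open>The measure \<open>\<mu>\<close>\<close>

text \<open>Constant maps have zero increments, so \<open>J\<close> vanishes on them at every scale;
  its limit is a coordinate of the integral.\<close>

lemma integral_f: "(LINT x|lborel. f x) = 0"
proof (rule euclidean_eqI)
  fix i :: 'b assume "i \<in> Basis"
  have "(\<lambda>k. J (\<epsilon>\<^sub>0 k) (\<lambda>_. i)) \<longlonglongrightarrow> (LINT x|lborel. i \<bullet> f x)"
    by (intro tendsto_J \<epsilon>\<^sub>0 continuous_intros)
  then have "(LINT x|lborel. i \<bullet> f x) = 0"
    by (simp add: J_def LIMSEQ_const_iff)
  then show "(LINT x|lborel. f x) \<bullet> i = 0 \<bullet> i"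
    using integrable_f by (simp add: inner_commute)
qed

lemma vector_measure_\<mu>: "vector_measure \<mu>"
  unfolding \<mu>_def by (intro vector_measure_pushforward integrable_f) simp

lemma \<mu>_in_W1: "\<mu> \<in> W1"
proof -
  \<comment> \<open>Adding the pushforward of the zero density, which vanishes, brings
    \<open>\<mu>\<close> into the form of the two-term bound.\<close>
  have "(\<integral>\<^sup>+x. ennreal (norm (x - 0)) \<partial>total_variation (\<lambda>A. \<mu> A + pushforward lborel (\<lambda>x. x) (\<lambda>_. 0) A))
      \<le> (\<integral>\<^sup>+x. ennreal (norm (f x)) * ennreal (norm (x - 0)) \<partial>lborel)
        + (\<integral>\<^sup>+x. ennreal (norm (0 :: 'b)) * ennreal (norm (x - 0)) \<partial>(lborel :: 'a measure))"
    unfolding \<mu>_def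
    by (intro nn_integral_total_variation_pushforward_add_le integrable_f) auto
  also have "\<dots> = (\<integral>\<^sup>+x. ennreal (norm x * norm (f x)) \<partial>lborel)"
    by (simp add: ennreal_mult mult.commute)
  also have "\<dots> = ennreal (LINT x|lborel. norm x * norm (f x))"
    using norm_strip_le(1)
    by (intro nn_integral_eq_integral integrable_mult_norm[where C = 1] continuous_intros) auto
  also have "\<dots> < \<infinity>" by simp
  finally have "(\<integral>\<^sup>+x. ennreal (norm (x - 0)) \<partial>total_variation \<mu>) < \<infinity>"
    by (simp add: pushforward_def)
  then show ?thesis
    using vector_measure_\<mu> integral_f unfolding W1_def
    by (auto simp: \<mu>_def pushforward_def intro!: exI[of _ 0])
qed

lemma vector_absolutely_continuous_\<mu>: "vector_absolutely_continuous lborel \<mu>"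
  unfolding vector_absolutely_continuous_def
proof
  fix A :: "'a set" assume "A \<in> null_sets lborel"
  then have "AE x in lborel. indicator A x *\<^sub>R f x = 0"
    by (rule AE_mp[OF AE_not_in]) auto
  then show "\<mu> A = 0"
    unfolding \<mu>_def pushforward_def by (rule integral_eq_zero_AE)
qed

section \<open>Transport cost\<close>

text \<open>One summand carries \<open>H x /\<^sub>R \<epsilon>\<close> over the distance
  \<epsilon>, at a cost bounded by the integral of \<open>h\<close>; the other carries the error
  \<open>q \<epsilon>\<close> to the origin. As \<open>q \<epsilon>\<close> has integral 0, no mass
  is left at the origin and the marginals differ exactly by \<open>\<mu>\<close>.\<close>

lemma couplings_cost_le:
  assumes \<epsilon>: "0 < \<epsilon>" "\<epsilon> \<le> pi"
  obtains \<pi> where "\<pi> \<in> couplings \<mu>"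
    "transport_cost \<pi> \<le> ennreal ((LINT x|lborel. h x) + (LINT x|lborel. norm x * norm (q \<epsilon> x)))"
proof
  let ?T = "\<lambda>x::'a. (x, x + \<epsilon> *\<^sub>R e)" and ?T' = "\<lambda>x::'a. (x, 0::'a)"
  let ?\<pi> = "\<lambda>A. pushforward lborel ?T (\<lambda>x. H x /\<^sub>R \<epsilon>) A + pushforward lborel ?T' (q \<epsilon>) A"
  have T: "?T \<in> lborel \<rightarrow>\<^sub>M borel" "?T' \<in> lborel \<rightarrow>\<^sub>M borel"
    by (auto intro!: borel_measurable_continuous_onI continuous_intros)
  have H': "integrable lborel (\<lambda>x. H (x - \<epsilon> *\<^sub>R e))"
    using integrable_distr_eq[of "(+) (- \<epsilon> *\<^sub>R e)" lborel borel H] integrable_H lborel_distr_plus[of "- \<epsilon> *\<^sub>R e"]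
    by simp
  have intH: "integrable lborel (\<lambda>x. H x /\<^sub>R \<epsilon>)" and intq: "integrable lborel (q \<epsilon>)"
    unfolding q_def[abs_def] using integrable_H integrable_f H' by auto
  show "?\<pi> \<in> couplings \<mu>"
    unfolding couplings_def
  proof (intro CollectI conjI ballI)
    show "vector_measure ?\<pi>"
      by (intro vector_measure_add vector_measure_pushforward T intH intq)
    fix A :: "'a set" assume A [measurable]: "A \<in> sets borel"
    have ind: "integrable lborel (\<lambda>x. indicator A x *\<^sub>R F x)" if "integrable lborel F" for F :: "'a \<Rightarrow> 'b"
      using integrable_indicator_comp[OF _ that A, of "\<lambda>x. x"] by simp
    have "(LINT x|lborel. indicator A (x + \<epsilon> *\<^sub>R e) *\<^sub>R H x) = (LINT x|lborel. indicator A x *\<^sub>R H (x - \<epsilon> *\<^sub>R e))"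
      using lborel_integral_translate[of "\<lambda>x. indicator A x *\<^sub>R H (x - \<epsilon> *\<^sub>R e)" "\<epsilon> *\<^sub>R e"] by simp
    moreover have "(LINT x|lborel. q \<epsilon> x) = 0"
      using integrable_f integrable_H H' integral_f lborel_integral_translate[of H "- \<epsilon> *\<^sub>R e"]
      by (simp add: q_def)
    moreover have "(LINT x|lborel. indicator A x *\<^sub>R q \<epsilon> x) = (LINT x|lborel. indicator A x *\<^sub>R f x)
        - ((LINT x|lborel. indicator A x *\<^sub>R H x) - (LINT x|lborel. indicator A x *\<^sub>R H (x - \<epsilon> *\<^sub>R e))) /\<^sub>R \<epsilon>"
    proof -
      have "(\<lambda>x. indicator A x *\<^sub>R q \<epsilon> x) = (\<lambda>x. indicator A x *\<^sub>R f x
          - (indicator A x *\<^sub>R H x - indicator A x *\<^sub>R H (x - \<epsilon> *\<^sub>R e)) /\<^sub>R \<epsilon>)"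
        by (simp add: q_def fun_eq_iff algebra_simps)
      then show ?thesis
        using ind[OF integrable_f] ind[OF integrable_H] ind[OF H']
        by (simp del: scaleR_scaleR)
    qed
    ultimately show "?\<pi> (A \<times> UNIV) - ?\<pi> (UNIV \<times> A) = \<mu> A"
      by (simp add: pushforward_def \<mu>_def indicator_times scaleR_left_commute[of _ "inverse \<epsilon>"] scaleR_diff_right del: scaleR_scaleR)
  qed
  have "transport_cost ?\<pi> \<le> (\<integral>\<^sup>+x. ennreal (norm (H x /\<^sub>R \<epsilon>)) * (case ?T x of (x, y) \<Rightarrow> ennreal (norm (x - y))) \<partial>lborel)
      + (\<integral>\<^sup>+x. ennreal (norm (q \<epsilon> x)) * (case ?T' x of (x, y) \<Rightarrow> ennreal (norm (x - y))) \<partial>lborel)"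
    unfolding transport_cost_def
  proof (intro nn_integral_total_variation_pushforward_add_le T intH intq)
    have "(\<lambda>z::'a\<times>'a. norm (fst z - snd z)) \<in> borel_measurable borel"
      by (intro borel_measurable_continuous_onI continuous_intros)
    then show "(\<lambda>(x, y). ennreal (norm (x - y))) \<in> borel_measurable (borel :: ('a \<times> 'a) measure)"
      by (simp add: case_prod_beta')
  qed
  also have "\<dots> = (\<integral>\<^sup>+x. ennreal (h x) \<partial>lborel) + (\<integral>\<^sup>+x. ennreal (norm x * norm (q \<epsilon> x)) \<partial>lborel)"
  proof -
    have "ennreal (norm (H x /\<^sub>R \<epsilon>)) * (case ?T x of (x, y) \<Rightarrow> ennreal (norm (x - y))) = ennreal (h x)" for x
    proof -
      have "norm (H x /\<^sub>R \<epsilon>) * \<epsilon> = h x"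
        using \<epsilon>(1) by (simp add: norm_H)
      then show ?thesis
        using \<epsilon>(1) e by (simp del: norm_scaleR flip: ennreal_mult'') simp
    qed
    moreover have "ennreal (norm (q \<epsilon> x)) * (case ?T' x of (x, y) \<Rightarrow> ennreal (norm (x - y)))
        = ennreal (norm x * norm (q \<epsilon> x))" for x
      by (simp add: ennreal_mult mult.commute)
    ultimately show ?thesis
      by (simp only:)
  qed
  also have "\<dots> = ennreal (LINT x|lborel. h x) + ennreal (LINT x|lborel. norm x * norm (q \<epsilon> x))"
    using h_nonneg norm_q_le[OF \<epsilon>]
    by (intro arg_cong2[where f = "(+)"] nn_integral_eq_integral integrable_h
        integrable_mult_norm[where C = 2] continuous_intros) auto
  also have "\<dots> = ennreal ((LINT x|lborel. h x) + (LINT x|lborel. norm x * norm (q \<epsilon> x)))"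
    using h_nonneg by (intro ennreal_plus[symmetric] integral_nonneg_AE) auto
  finally show "transport_cost ?\<pi> \<le> ennreal ((LINT x|lborel. h x) + (LINT x|lborel. norm x * norm (q \<epsilon> x)))" .
qed

lemma INF_transport_cost_le: "(INF \<pi>\<in>couplings \<mu>. transport_cost \<pi>) \<le> ennreal (LINT x|lborel. h x)"
proof (rule LIMSEQ_le_const)
  have "(\<lambda>k. LINT x|lborel. norm x * norm (q (\<epsilon>\<^sub>0 k) x)) \<longlonglongrightarrow> 0"
    by (intro tendsto_integral_norm_q \<epsilon>\<^sub>0 continuous_intros)
  from tendsto_add[OF tendsto_const this, of "LINT x|lborel. h x"]
  show "(\<lambda>k. ennreal ((LINT x|lborel. h x) + (LINT x|lborel. norm x * norm (q (\<epsilon>\<^sub>0 k) x)))) \<longlonglongrightarrow> ennreal (LINT x|lborel. h x)"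
    by (intro tendsto_ennrealI) simp
  have "(INF \<pi>\<in>couplings \<mu>. transport_cost \<pi>) \<le> ennreal ((LINT x|lborel. h x) + (LINT x|lborel. norm x * norm (q (\<epsilon>\<^sub>0 k) x)))" for k
    using couplings_cost_le[OF \<epsilon>\<^sub>0(1,2)] by (metis INF_lower2)
  then show "\<exists>N. \<forall>k\<ge>N. (INF \<pi>\<in>couplings \<mu>. transport_cost \<pi>)
      \<le> ennreal ((LINT x|lborel. h x) + (LINT x|lborel. norm x * norm (q (\<epsilon>\<^sub>0 k) x)))"
    by blast
qed

lemma integral_h_pos: "0 < (LINT x|lborel. h x)"
proof (rule ccontr)
  assume "\<not> 0 < (LINT x|lborel. h x)"
  then have "(LINT x|lborel. h x) = 0"
    using h_nonneg by (simp add: integral_nonneg_AE not_less antisym)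
  then have "AE x in lborel. h x = 0"
    using h_nonneg integrable_h by (subst (asm) integral_nonneg_eq_0_iff_AE) auto
  then have "AE x in lborel. x \<in> U \<longrightarrow> x \<in> {}"
    by eventually_elim (use sin_gt_zero in \<open>force simp: h_def mem_U\<close>)
  moreover have "(1/2) *\<^sub>R One \<in> U"
    using pi_gt3 e by (auto simp: mem_U)
  ultimately show False
    using AE_lborel_open_imp_closed[OF open_U closed_empty] by blast
qed

text \<open>For an optimal \<open>\<pi>\<close> the integral of \<open>h\<close> is at most that of
  \<open>norm (u x - u y)\<close>, which is at most that of \<open>norm (x - y)\<close>, which is at
  most that of \<open>h\<close>. Equality throughout and the strictness of \<open>u\<close> put the
  total variation of \<open>\<pi>\<close> on the diagonal, where the second integrand is 0, although
  the integral of \<open>h\<close> is positive.\<close>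

lemma not_optimal_transport: "\<not> optimal_transport \<mu> \<pi>"
proof
  assume opt: "optimal_transport \<mu> \<pi>"
  then have \<pi>: "\<pi> \<in> couplings \<mu>" and "transport_cost \<pi> \<le> ennreal (LINT x|lborel. h x)"
    using INF_transport_cost_le by (auto simp: optimal_transport_def)
  then have cost: "(\<integral>\<^sup>+z. ennreal (norm (fst z - snd z)) \<partial>total_variation \<pi>) \<le> ennreal (LINT x|lborel. h x)"
    by (simp add: transport_cost_def case_prod_beta')
  let ?N = "total_variation \<pi>"
  have [measurable]: "fst \<in> borel \<rightarrow>\<^sub>M (borel :: 'a measure)" "snd \<in> borel \<rightarrow>\<^sub>M (borel :: 'a measure)"
    by (auto intro!: borel_measurable_continuous_onI continuous_intros)
  have [measurable]: "u \<in> borel_measurable borel"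
    using lipschitz_on_continuous_on[OF lipschitz_u] by (rule borel_measurable_continuous_onI)
  have int: "integrable ?N (\<lambda>z. norm (fst z - snd z))"
    using cost by (intro integrableI_bounded) (auto simp: top.not_eq_extremum intro: order_le_less_trans)
  have le: "norm (u x - u y) \<le> norm (x - y)" for x y
    using lipschitz_u by (rule lipschitz_on_1_norm_diff)
  have intu: "integrable ?N (\<lambda>z. norm (u (fst z) - u (snd z)))"
    by (rule Bochner_Integration.integrable_bound[OF int]) (auto simp: le)
  have "(LINT z|?N. norm (fst z - snd z)) \<le> (LINT x|lborel. h x)"
    using cost h_nonneg by (simp add: nn_integral_eq_integral[OF int] ennreal_le_iff integral_nonneg_AE)
  also have "\<dots> = (LINT x|lborel. u x \<bullet> f x)"
    by (simp add: u_inner_f)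
  also have "\<dots> \<le> (LINT z|?N. norm (u (fst z) - u (snd z)))"
    by (rule bounded_inner_integral_coupling_le[where C = 1])
      (use \<pi> integrable_f in \<open>auto simp: \<mu>_def u_def\<close>)
  finally have "(LINT z|?N. norm (fst z - snd z) - norm (u (fst z) - u (snd z))) \<le> 0"
    using int intu by simp
  then have "(LINT z|?N. norm (fst z - snd z) - norm (u (fst z) - u (snd z))) = 0"
    using le by (intro antisym integral_nonneg_AE) auto
  then have "AE z in ?N. norm (fst z - snd z) - norm (u (fst z) - u (snd z)) = 0"
    using int intu le by (subst (asm) integral_nonneg_eq_0_iff_AE) auto
  then have "AE z in ?N. norm (u (fst z) - u (snd z)) = 0"
  proof eventually_elim
    case (elim z)
    then show ?case
      using u_dist_less[of "fst z" "snd z"] by (cases "fst z = snd z") auto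
  qed
  then have "(LINT z|?N. norm (u (fst z) - u (snd z))) = 0"
    by (rule integral_eq_zero_AE)
  then show False
    using integral_h_pos \<open>(LINT x|lborel. h x) = (LINT x|lborel. u x \<bullet> f x)\<close>
      \<open>(LINT x|lborel. u x \<bullet> f x) \<le> (LINT z|?N. norm (u (fst z) - u (snd z)))\<close> by simp
qed

section \<open>Rigidity of optimal potentials\<close>

text \<open>A vector of norm at most \<epsilon> whose inner product with the unit vector
  \<open>g t\<close> is nearly \<epsilon> is close to \<open>\<epsilon> *\<^sub>R g t\<close>;
  expanding the square makes this quantitative.\<close>

lemma increment_gap:
  assumes v: "1-lipschitz_on UNIV v" and \<epsilon>: "0 < \<epsilon>"
  shows "(norm ((v x - v (x + \<epsilon> *\<^sub>R e)) - \<epsilon> *\<^sub>R g t))\<^sup>2 \<le> 2 * \<epsilon> * (\<epsilon> - (v x - v (x + \<epsilon> *\<^sub>R e)) \<bullet> g t)"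
proof -
  let ?d = "v x - v (x + \<epsilon> *\<^sub>R e)"
  have "norm ?d \<le> \<epsilon>"
    using lipschitz_on_1_norm_diff[OF v, of x "x + \<epsilon> *\<^sub>R e"] e \<epsilon> by simp
  then have "(norm ?d)\<^sup>2 \<le> \<epsilon>\<^sup>2"
    by (intro power_mono) auto
  moreover have "(norm (?d - \<epsilon> *\<^sub>R g t))\<^sup>2 = \<epsilon>\<^sup>2 - 2 * \<epsilon> * (?d \<bullet> g t) + (norm ?d)\<^sup>2"
    using norm_scaleR_add_power2[of "- \<epsilon>" "g t" ?d] by (simp add: inner_commute)
  ultimately show ?thesis
    by (simp add: power2_eq_square algebra_simps)
qed

text \<open>Optimality of both maps forces their difference quotients in the direction \<open>e\<close> to converge to
  \<open>g\<close> in \<open>L\<^sup>2(h)\<close>; telescoping over a subdivision of \<open>[0, s]\<close> then transfers this to the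
  increments of length \<open>s\<close>.\<close>

lemma optimal_potential_increment:
  assumes v: "optimal_potential \<mu> v" and p: "p \<in> U" "p + s *\<^sub>R e \<in> U" and s: "0 < s"
  shows "v p - v (p + s *\<^sub>R e) = u p - u (p + s *\<^sub>R e)"
proof -
  have lip: "1-lipschitz_on UNIV v" and opt: "(LINT x|lborel. v x \<bullet> f x) = (LINT x|lborel. h x)"
    using v by (auto simp: optimal_potential_iff)
  have cv: "continuous_on UNIV v" and cu: "continuous_on UNIV u"
    using lip lipschitz_u by (auto intro: lipschitz_on_continuous_on)
  let ?I = "LINT x|lborel. h x"
  define w where "w x = v x - u x" for x
  have cw [continuous_intros]: "continuous_on UNIV (\<lambda>x::'a. w (k x))" if "continuous_on UNIV k" for k
    unfolding w_def by (intro continuous_intros continuous_on_compose2[OF cv that] continuous_on_compose2[OF cu that]) auto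
  \<comment> \<open>Steps dividing \<open>s\<close> into exactly \<open>Suc k\<close> equal parts,
    so that the telescoping sum ends after the full length \<open>s\<close>.\<close>
  define \<epsilon> where "\<epsilon> k = s / real (Suc k)" for k
  have "s < pi" using p s by (simp add: mem_U inner_translate)
  have \<epsilon>: "0 < \<epsilon> k" "\<epsilon> k \<le> pi" for k
  proof -
    have "\<epsilon> k \<le> s" using s by (simp add: \<epsilon>_def field_simps)
    then show "\<epsilon> k \<le> pi" using \<open>s < pi\<close> by simp
  qed (use s in \<open>simp add: \<epsilon>_def\<close>)
  have \<epsilon>0: "\<epsilon> \<longlonglongrightarrow> 0"
    using tendsto_mult_right_zero[OF LIMSEQ_inverse_real_of_nat, of s]
    by (simp add: \<epsilon>_def[abs_def] divide_inverse)
  define \<delta> where "\<delta> k x = (norm (w x - w (x + \<epsilon> k *\<^sub>R e)))\<^sup>2 * norm (H x)" for k x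
  have int_\<delta>: "integrable lborel (\<delta> k)" for k
    unfolding \<delta>_def[abs_def] using norm_strip_le(2)
    by (intro integrable_mult_norm[where C = 1] continuous_intros) auto
  \<comment> \<open>The joint deficit of the two potentials at scale \<open>\<epsilon> k\<close>.
    Both have integral \<open>?I\<close> against \<open>f\<close>, so it tends to 0.\<close>
  define D where "D k = 2 * ?I - J (\<epsilon> k) v - J (\<epsilon> k) u" for k
  have "D \<longlonglongrightarrow> 2 * ?I - ?I - ?I"
    unfolding D_def[abs_def] using tendsto_J[OF cv \<epsilon> \<epsilon>0] tendsto_J[OF cu \<epsilon> \<epsilon>0]
    by (intro tendsto_intros) (simp_all add: opt u_inner_f)
  then have D: "D \<longlonglongrightarrow> 0" by simp
  have \<delta>_le: "(LINT x|lborel. \<delta> k x) \<le> 4 * (\<epsilon> k)\<^sup>2 * D k" for k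
  proof -
    let ?\<epsilon> = "\<epsilon> k"
    let ?V = "\<lambda>x. v x - v (x + ?\<epsilon> *\<^sub>R e)" and ?W = "\<lambda>x. u x - u (x + ?\<epsilon> *\<^sub>R e)"
    have "\<delta> k x \<le> 4 * ?\<epsilon> * (2 * ?\<epsilon> * h x - ?V x \<bullet> H x - ?W x \<bullet> H x)" for x
    proof -
      let ?g = "g (x \<bullet> e)"
      have "(norm (w x - w (x + ?\<epsilon> *\<^sub>R e)))\<^sup>2 = (norm (?V x - ?W x))\<^sup>2"
        by (simp add: w_def algebra_simps)
      \<comment> \<open>Both increments are nearly \<open>?\<epsilon> *\<^sub>R ?g\<close> when the
        deficit is small, so this vector serves as intermediate point.\<close>
      also have "\<dots> \<le> 2 * (norm (?V x - ?\<epsilon> *\<^sub>R ?g))\<^sup>2 + 2 * (norm (?W x - ?\<epsilon> *\<^sub>R ?g))\<^sup>2"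
        by (rule norm_diff_power2_le)
      also have "\<dots> \<le> 2 * (2 * ?\<epsilon> * (?\<epsilon> - ?V x \<bullet> ?g)) + 2 * (2 * ?\<epsilon> * (?\<epsilon> - ?W x \<bullet> ?g))"
        by (intro add_mono mult_left_mono increment_gap lip lipschitz_u \<epsilon>(1)) auto
      finally have "\<delta> k x \<le> (2 * (2 * ?\<epsilon> * (?\<epsilon> - ?V x \<bullet> ?g)) + 2 * (2 * ?\<epsilon> * (?\<epsilon> - ?W x \<bullet> ?g))) * h x"
        unfolding \<delta>_def norm_H using h_nonneg by (intro mult_right_mono)
      also have "\<dots> = 4 * ?\<epsilon> * (2 * ?\<epsilon> * h x - ?V x \<bullet> H x - ?W x \<bullet> H x)"
        by (simp add: H_def algebra_simps)
      finally show ?thesis .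
    qed
    then have "(LINT x|lborel. \<delta> k x) \<le> (LINT x|lborel. 4 * ?\<epsilon> * (2 * ?\<epsilon> * h x - ?V x \<bullet> H x - ?W x \<bullet> H x))"
      by (intro integral_mono int_\<delta> integrable_mult_right Bochner_Integration.integrable_diff
          integrable_h integrable_J cv cu)
    also have "\<dots> = 4 * ?\<epsilon> * (2 * ?\<epsilon> * ?I - ?\<epsilon> * J ?\<epsilon> v - ?\<epsilon> * J ?\<epsilon> u)"
      using \<epsilon>(1)[of k] by (simp add: integrable_h integrable_J cv cu J_def)
    also have "\<dots> = 4 * ?\<epsilon>\<^sup>2 * D k"
      by (simp add: D_def power2_eq_square algebra_simps)
    finally show ?thesis .
  qed
  \<comment> \<open>For \<open>y\<close> in the neighbourhood \<open>V\<close> of \<open>p\<close>,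
    the whole segment from \<open>y\<close> to \<open>y + s *\<^sub>R e\<close> keeps distance at
    least \<eta> from the faces where the sine vanishes, so \<open>h\<close> is bounded below by
    \<open>sin \<eta>\<close> on it.\<close>
  define \<eta> where "\<eta> = min (p \<bullet> e) (pi - p \<bullet> e - s) / 2"
  have \<eta>: "0 < \<eta>" "\<eta> < p \<bullet> e" "p \<bullet> e + s < pi - \<eta>"
    using p by (auto simp: \<eta>_def mem_U inner_translate min_def field_simps)
  define V where "V = {y. y \<in> U \<and> \<eta> < y \<bullet> e \<and> y \<bullet> e + s < pi - \<eta>}"
  have V: "open V" unfolding V_def
    using open_U by (intro open_Collect_conj open_Collect_less continuous_intros) auto
  have "p \<in> V" using p \<eta> by (simp add: V_def)
  have h_ge: "sin \<eta> \<le> norm (H (y + r *\<^sub>R e))" if "y \<in> V" "0 \<le> r" "r \<le> s" for y r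
  proof -
    have y: "\<eta> \<le> y \<bullet> e + r" "y \<bullet> e + r \<le> pi - \<eta>" "y + r *\<^sub>R e \<in> U"
      using that \<eta>(1) by (auto simp: V_def mem_U inner_translate)
    have "sin \<eta> \<le> sin (y \<bullet> e + r)"
    proof (cases "y \<bullet> e + r \<le> pi / 2")
      case True
      then show ?thesis using y \<eta> by (intro sin_monotone_2pi_le) auto
    next
      case False
      then have "sin \<eta> \<le> sin (pi - (y \<bullet> e + r))"
        using y \<eta> by (intro sin_monotone_2pi_le) auto
      then show ?thesis by simp
    qed
    then show ?thesis
      using y(3) by (simp add: norm_H h_def inner_translate)
  qed
  have "0 < sin \<eta>"
    using \<eta> p s by (intro sin_gt_zero) (auto simp: mem_U)
  \<comment> \<open>The unit vector \<open>a\<close> turns the indicator of \<open>V\<close> into a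
    vector-valued factor, so that \<open>integrable_mult_norm\<close> applies.\<close>
  define \<Phi> where "\<Phi> y = (norm (w y - w (y + s *\<^sub>R e)))\<^sup>2 * norm (indicator V y *\<^sub>R a)" for y
  have int_\<Phi>: "integrable lborel \<Phi>"
  proof -
    have [measurable]: "V \<in> sets borel" using V by simp
    have "V \<subseteq> B" using U_subset_B by (auto simp: V_def)
    then show ?thesis
      unfolding \<Phi>_def using a
      by (intro integrable_mult_norm[where C = 1] continuous_intros) (auto split: split_indicator)
  qed
  \<comment> \<open>Telescoping with Cauchy-Schwarz costs one factor \<open>Suc k\<close>, and the
    sum of equal translated integrals another. Both cancel against
    \<open>(\<epsilon> k)\<^sup>2\<close>, so only \<open>D k\<close> still depends on
    \<open>k\<close>.\<close>
  have \<Phi>_le: "(LINT y|lborel. \<Phi> y) \<le> 4 * s\<^sup>2 / sin \<eta> * D k" for k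
  proof -
    let ?y = "\<lambda>y j. y + (real j * \<epsilon> k) *\<^sub>R e"
    have "\<Phi> y \<le> real (Suc k) / sin \<eta> * (\<Sum>j<Suc k. \<delta> k (?y y j))" for y
    proof (cases "y \<in> V")
      case True
      have Suc: "?y y (Suc j) = ?y y j + \<epsilon> k *\<^sub>R e" for j
        by (simp add: algebra_simps)
      have stop: "?y y (Suc k) = y + s *\<^sub>R e" and start: "?y y 0 = y"
        by (simp_all add: \<epsilon>_def)
      have "(\<Sum>j<Suc k. w (?y y j) - w (?y y (Suc j))) = w (?y y 0) - w (?y y (Suc k))"
        by (rule sum_lessThan_telescope')
      then have "w y - w (y + s *\<^sub>R e) = (\<Sum>j<Suc k. w (?y y j) - w (?y y (Suc j)))"
        unfolding start stop by (rule sym)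
      then have "norm (w y - w (y + s *\<^sub>R e)) \<le> (\<Sum>j<Suc k. norm (w (?y y j) - w (?y y j + \<epsilon> k *\<^sub>R e)))"
        unfolding Suc by (simp only: norm_sum)
      then have "(norm (w y - w (y + s *\<^sub>R e)))\<^sup>2 \<le> (\<Sum>j<Suc k. norm (w (?y y j) - w (?y y j + \<epsilon> k *\<^sub>R e)))\<^sup>2"
        by (intro power_mono) auto
      also have "\<dots> \<le> (\<Sum>j<Suc k. (norm (w (?y y j) - w (?y y j + \<epsilon> k *\<^sub>R e)))\<^sup>2) * card {..<Suc k}"
        by (rule sum_squared_le_sum_of_squares)
      also have "\<dots> \<le> (\<Sum>j<Suc k. \<delta> k (?y y j) / sin \<eta>) * card {..<Suc k}"
      proof (intro mult_right_mono sum_mono)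
        fix j assume "j \<in> {..<Suc k}"
        then have "real j * s \<le> real (Suc k) * s"
          using s by (intro mult_right_mono) auto
        then have "real j * \<epsilon> k \<le> s"
          by (simp add: \<epsilon>_def pos_divide_le_eq mult.commute)
        then have "sin \<eta> \<le> norm (H (?y y j))"
          using True \<epsilon>(1)[of k] by (intro h_ge) auto
        then show "(norm (w (?y y j) - w (?y y j + \<epsilon> k *\<^sub>R e)))\<^sup>2 \<le> \<delta> k (?y y j) / sin \<eta>"
          using \<open>0 < sin \<eta>\<close> by (simp add: \<delta>_def pos_le_divide_eq mult_left_mono)
      qed simp
      finally show ?thesis
        using True a by (simp add: \<Phi>_def mult.commute del: sum.lessThan_Suc flip: sum_divide_distrib)
    next
      case False
      moreover have "0 \<le> real (Suc k) / sin \<eta> * (\<Sum>j<Suc k. \<delta> k (?y y j))"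
        using \<open>0 < sin \<eta>\<close> by (intro mult_nonneg_nonneg divide_nonneg_nonneg sum_nonneg) (auto simp: \<delta>_def)
      ultimately show ?thesis
        by (simp add: \<Phi>_def)
    qed
    then have "(LINT y|lborel. \<Phi> y) \<le> (LINT y|lborel. real (Suc k) / sin \<eta> * (\<Sum>j<Suc k. \<delta> k (?y y j)))"
      by (intro integral_mono int_\<Phi> integrable_mult_right Bochner_Integration.integrable_sum
          lborel_integrable_translate int_\<delta>)
    also have "\<dots> = real (Suc k) / sin \<eta> * (\<Sum>j<Suc k. (LINT y|lborel. \<delta> k (?y y j)))"
      by (simp only: integral_mult_right_zero Bochner_Integration.integral_sum lborel_integrable_translate int_\<delta>)
    also have "\<dots> = real (Suc k) / sin \<eta> * (real (Suc k) * (LINT y|lborel. \<delta> k y))"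
      using int_\<delta>[of k] by (simp add: lborel_integral_translate del: sum.lessThan_Suc)
    also have "\<dots> \<le> real (Suc k) / sin \<eta> * (real (Suc k) * (4 * (\<epsilon> k)\<^sup>2 * D k))"
      using \<open>0 < sin \<eta>\<close> by (intro mult_left_mono \<delta>_le) auto
    also have "\<dots> = 4 * s\<^sup>2 / sin \<eta> * D k"
      by (simp add: \<epsilon>_def power2_eq_square)
    finally show ?thesis .
  qed
  have "(LINT y|lborel. \<Phi> y) \<le> 4 * s\<^sup>2 / sin \<eta> * 0"
    by (rule LIMSEQ_le_const[OF tendsto_mult[OF tendsto_const D]]) (use \<Phi>_le in auto)
  then have "(LINT y|lborel. \<Phi> y) = 0"
    by (intro antisym integral_nonneg_AE) (auto simp: \<Phi>_def)
  then have "AE y in lborel. \<Phi> y = 0"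
    using int_\<Phi> by (subst (asm) integral_nonneg_eq_0_iff_AE) (auto simp: \<Phi>_def)
  then have "AE y in lborel. y \<in> V \<longrightarrow> y \<in> {y. w y = w (y + s *\<^sub>R e)}"
    by eventually_elim (use a in \<open>auto simp: \<Phi>_def\<close>)
  moreover have "closed {y. w y = w (y + s *\<^sub>R e)}"
    by (intro closed_Collect_eq continuous_intros)
  ultimately have "w p = w (p + s *\<^sub>R e)"
    using AE_lborel_open_imp_closed[OF V _ _ \<open>p \<in> V\<close>] by blast
  then show ?thesis
    by (simp add: w_def algebra_simps)
qed

text \<open>\<open>v\<close> is affine on the segment from \<open>p\<close> to \<open>z\<close>,
  while its increments along \<open>e\<close> inside \<open>U\<close> are those of \<open>u\<close>.
  Reconciling the two with the Lipschitz bound prescribes the inner product of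
  \<open>v z - v p\<close> with \<open>g\<close> along the part of the segment in \<open>U\<close>.
  Were the levels different, a nonzero sinusoid would be constant on an interval.\<close>

lemma optimal_potential_isometric_imp_same_level:
  assumes v: "optimal_potential \<mu> v" and p: "p \<in> U" and z: "dist (v p) (v z) = dist p z"
  shows "z \<bullet> e = p \<bullet> e"
proof (rule ccontr)
  assume ne: "z \<bullet> e \<noteq> p \<bullet> e"
  have lip: "1-lipschitz_on UNIV v"
    using v by (simp add: optimal_potential_iff)
  define d where "d = z - p"
  define Z where "Z = v z - v p"
  have Z: "norm Z = norm d" and de: "d \<bullet> e \<noteq> 0"
    using z ne by (auto simp: Z_def d_def dist_norm norm_minus_commute inner_diff_left)
  have seg: "v (p + t *\<^sub>R d) = v p + t *\<^sub>R Z" if "0 \<le> t" "t \<le> 1" for t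
    using lipschitz_1_segment[OF lip, of p d t] that z
    by (simp add: Z_def d_def dist_norm norm_minus_commute)
  have "((\<lambda>t. p + t *\<^sub>R d) \<longlongrightarrow> p + 0 *\<^sub>R d) (at_right 0)"
    by (intro tendsto_intros)
  then have "\<forall>\<^sub>F t in at_right 0. p + t *\<^sub>R d \<in> U"
    using topological_tendstoD[OF _ open_U] p by fastforce
  then obtain T0 where T0: "0 < T0" "\<And>t. 0 < t \<Longrightarrow> t < T0 \<Longrightarrow> p + t *\<^sub>R d \<in> U"
    by (auto simp: eventually_at_right_field)
  define T where "T = min T0 1"
  have T: "0 < T" "T \<le> 1" and inU: "\<And>t. 0 < t \<Longrightarrow> t < T \<Longrightarrow> p + t *\<^sub>R d \<in> U"
    using T0 by (auto simp: T_def)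
  \<comment> \<open>The Lipschitz bound between \<open>?x + \<sigma> *\<^sub>R e\<close> and points
    of the segment on either side of \<open>?x\<close> gives, to first order in \<sigma>, two
    opposite inequalities.\<close>
  have key: "- (Z \<bullet> g (p \<bullet> e + t * (d \<bullet> e))) = d \<bullet> e" if t: "0 < t" "t < T" for t
  proof -
    let ?x = "p + t *\<^sub>R d"
    define \<theta> where "\<theta> = p \<bullet> e + t * (d \<bullet> e)"
    have \<theta>: "?x \<bullet> e = \<theta>" by (simp add: \<theta>_def inner_add_left)
    \<comment> \<open>This is the inner product of \<open>Z\<close> with
      \<open>u (?x + \<sigma> *\<^sub>R e)\<close>; owing to the shift by pi/2 its derivative at 0
      involves \<open>- g \<theta>\<close>.\<close>
    define \<psi> where "\<psi> \<sigma> = Z \<bullet> g (\<theta> + \<sigma> + pi / 2)" for \<sigma>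
    have "(\<psi> has_real_derivative - (Z \<bullet> g \<theta>)) (at 0)"
      unfolding \<psi>_def g_def inner_add_right inner_scaleR_right
      by (auto intro!: derivative_eq_intros simp: cos_add sin_add algebra_simps)
    then have "((\<lambda>\<sigma>. (\<psi> \<sigma> - \<psi> 0) / \<sigma>) \<longlongrightarrow> - (Z \<bullet> g \<theta>)) (at 0)"
      by (simp add: DERIV_def)
    then have lim: "((\<lambda>\<sigma>. (\<psi> \<sigma> - \<psi> 0) / \<sigma>) \<longlongrightarrow> - (Z \<bullet> g \<theta>)) (at_right 0)"
      by (rule filterlim_mono) (simp_all add: at_le)
    have "((\<lambda>\<sigma>. ?x + \<sigma> *\<^sub>R e) \<longlongrightarrow> ?x + 0 *\<^sub>R e) (at_right 0)"
      by (intro tendsto_intros)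
    then have evU: "\<forall>\<^sub>F \<sigma> in at_right 0. ?x + \<sigma> *\<^sub>R e \<in> U"
      using topological_tendstoD[OF _ open_U] inU[OF t] by fastforce
    \<comment> \<open>\<open>r\<close> is a signed offset: \<open>p + (t - r) *\<^sub>R d\<close>
      lies behind \<open>?x\<close> for positive \<open>r\<close> and ahead of it for negative
      \<open>r\<close>.\<close>
    have le: "2 * r * (- (Z \<bullet> g \<theta>) - d \<bullet> e) \<le> 0" if r: "0 \<le> t - r" "t - r \<le> 1" for r
    proof (rule tendsto_le[OF trivial_limit_at_right_real])
      show "((\<lambda>\<sigma>. \<sigma>) \<longlongrightarrow> (0::real)) (at_right 0)" by (rule tendsto_ident_at)
      show "((\<lambda>\<sigma>. 2 * r * ((\<psi> \<sigma> - \<psi> 0) / \<sigma> - d \<bullet> e)) \<longlongrightarrow> 2 * r * (- (Z \<bullet> g \<theta>) - d \<bullet> e)) (at_right 0)"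
        by (intro tendsto_intros lim)
      show "\<forall>\<^sub>F \<sigma> in at_right 0. 2 * r * ((\<psi> \<sigma> - \<psi> 0) / \<sigma> - d \<bullet> e) \<le> \<sigma>"
        using evU eventually_at_right_less[of 0]
      proof eventually_elim
        case (elim \<sigma>)
        let ?\<Delta> = "u (?x + \<sigma> *\<^sub>R e) - u ?x"
        have "v (?x + \<sigma> *\<^sub>R e) - v ?x = ?\<Delta>"
          using optimal_potential_increment[OF v inU[OF t] elim] by (simp add: algebra_simps)
        moreover have "v ?x = v (p + (t - r) *\<^sub>R d) + r *\<^sub>R Z"
          using seg[of t] seg[of "t - r"] r t T by (simp add: algebra_simps)
        ultimately have "v (?x + \<sigma> *\<^sub>R e) - v (p + (t - r) *\<^sub>R d) = r *\<^sub>R Z + ?\<Delta>"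
          by (simp add: algebra_simps)
        then have "norm (r *\<^sub>R Z + ?\<Delta>) \<le> norm (?x + \<sigma> *\<^sub>R e - (p + (t - r) *\<^sub>R d))"
          using lipschitz_on_1_norm_diff[OF lip] by metis
        also have "?x + \<sigma> *\<^sub>R e - (p + (t - r) *\<^sub>R d) = r *\<^sub>R d + \<sigma> *\<^sub>R e"
          by (simp add: algebra_simps)
        finally have "(norm (r *\<^sub>R Z + ?\<Delta>))\<^sup>2 \<le> (norm (r *\<^sub>R d + \<sigma> *\<^sub>R e))\<^sup>2"
          by (intro power_mono) auto
        moreover have "(norm (r *\<^sub>R d + \<sigma> *\<^sub>R e))\<^sup>2 = r\<^sup>2 * (norm d)\<^sup>2 + 2 * r * \<sigma> * (d \<bullet> e) + \<sigma>\<^sup>2"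
          using e by (simp add: norm_scaleR_add_power2)
        moreover have "Z \<bullet> ?\<Delta> = \<psi> \<sigma> - \<psi> 0"
          by (simp add: u_def \<psi>_def inner_translate \<theta> inner_diff_right)
        then have "(norm (r *\<^sub>R Z + ?\<Delta>))\<^sup>2 = r\<^sup>2 * (norm d)\<^sup>2 + 2 * r * (\<psi> \<sigma> - \<psi> 0) + (norm ?\<Delta>)\<^sup>2"
          by (simp only: norm_scaleR_add_power2 Z)
        \<comment> \<open>The terms with \<open>(norm d)\<^sup>2\<close> cancel because
          \<open>norm Z = norm d\<close>; discarding the square of \<open>norm ?\<Delta>\<close>
          leaves a remainder quadratic in \<sigma>.\<close>
        ultimately have "2 * r * (\<psi> \<sigma> - \<psi> 0) - 2 * r * \<sigma> * (d \<bullet> e) \<le> \<sigma>\<^sup>2"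
          using zero_le_power2[of "norm ?\<Delta>"] by linarith
        moreover have "2 * r * ((\<psi> \<sigma> - \<psi> 0) / \<sigma> - d \<bullet> e) = (2 * r * (\<psi> \<sigma> - \<psi> 0) - 2 * r * \<sigma> * (d \<bullet> e)) / \<sigma>"
          using elim(2) by (simp add: field_simps)
        ultimately show ?case
          using elim(2) by (simp add: pos_divide_le_eq power2_eq_square)
      qed
    qed
    \<comment> \<open>The offsets \<open>t\<close> and \<open>t - T\<close> have opposite signs, so
      the two inequalities combine to an equality.\<close>
    have "2 * t * (- (Z \<bullet> g \<theta>) - d \<bullet> e) \<le> 0" "2 * (t - T) * (- (Z \<bullet> g \<theta>) - d \<bullet> e) \<le> 0"
      using le[of t] le[of "t - T"] t T by auto
    then have "- (Z \<bullet> g \<theta>) - d \<bullet> e = 0"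
      using t by (simp add: mult_le_0_iff)
    then show ?thesis by (simp add: \<theta>_def)
  qed
  \<comment> \<open>The parameters \<open>T / 4\<close>, \<open>T / 2\<close> and
    \<open>3 * T / 4\<close> are equally spaced, so the addition formulas relate the three values of
    \<open>g\<close> and yield \<open>cos \<eta> = 1\<close>.\<close>
  define \<theta> \<eta> where "\<theta> = p \<bullet> e + T / 2 * (d \<bullet> e)" and "\<eta> = T / 4 * (d \<bullet> e)"
  have Zg: "Z \<bullet> g \<theta> = - (d \<bullet> e)" "Z \<bullet> g (\<theta> + \<eta>) = - (d \<bullet> e)" "Z \<bullet> g (\<theta> - \<eta>) = - (d \<bullet> e)"
    using key[of "T / 2"] key[of "3 * T / 4"] key[of "T / 4"] T by (simp_all add: \<theta>_def \<eta>_def algebra_simps)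
  have "g (\<theta> + \<eta>) + g (\<theta> - \<eta>) = (2 * cos \<eta>) *\<^sub>R g \<theta>"
  proof -
    have "cos (\<theta> + \<eta>) + cos (\<theta> - \<eta>) = 2 * cos \<eta> * cos \<theta>" "sin (\<theta> + \<eta>) + sin (\<theta> - \<eta>) = 2 * cos \<eta> * sin \<theta>"
      by (simp_all add: cos_add cos_diff sin_add sin_diff)
    moreover have "g (\<theta> + \<eta>) + g (\<theta> - \<eta>)
        = (cos (\<theta> + \<eta>) + cos (\<theta> - \<eta>)) *\<^sub>R a + (sin (\<theta> + \<eta>) + sin (\<theta> - \<eta>)) *\<^sub>R b"
      by (simp add: g_def scaleR_add_left)
    ultimately show ?thesis
      by (simp add: g_def scaleR_add_right)
  qed
  then have "Z \<bullet> g (\<theta> + \<eta>) + Z \<bullet> g (\<theta> - \<eta>) = 2 * cos \<eta> * (Z \<bullet> g \<theta>)"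
    by (metis inner_add_right inner_scaleR_right)
  then have "(1 - cos \<eta>) * (d \<bullet> e) = 0"
    unfolding Zg by (simp add: algebra_simps)
  then have "cos \<eta> = 1"
    using de by simp
  \<comment> \<open>Both points lie in \<open>U\<close>, whose width along \<open>e\<close> is pi;
    this excludes that \<eta> is a nonzero multiple of 2 pi.\<close>
  have "(p + (3 * T / 4) *\<^sub>R d) \<bullet> e - (p + (T / 4) *\<^sub>R d) \<bullet> e = 2 * \<eta>"
    by (simp add: \<eta>_def inner_add_left)
  then have "\<bar>\<eta>\<bar> < pi"
    using inU[of "3 * T / 4"] inU[of "T / 4"] T by (auto simp: mem_U)
  moreover have "0 < \<bar>\<eta>\<bar>"
    using T de by (simp add: \<eta>_def)
  ultimately have "0 < sin \<bar>\<eta>\<bar>"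
    by (intro sin_gt_zero)
  then have "sin \<eta> \<noteq> 0"
    by (auto simp: abs_if split: if_splits)
  then show False
    using \<open>cos \<eta> = 1\<close> sin_cos_squared_add[of \<eta>] by simp
qed

section \<open>A transport set of non-zero measure\<close>

text \<open>Saturating a closed ball in the lower half of \<open>U\<close> stays on the levels of
  the ball, where \<open>f\<close> has the positive \<open>b\<close>-component
  \<open>sin (2 * (y \<bullet> e))\<close> on \<open>U\<close>. The saturation contains the ball
  itself, so the \<open>b\<close>-component of its measure is positive.\<close>

lemma optimal_potential_transport_set:
  assumes v: "optimal_potential \<mu> v"
  shows "\<exists>A. transport_set v A \<and> \<mu> A \<noteq> 0"
proof -
  have cv: "continuous_on UNIV v"
    using v by (auto simp: optimal_potential_iff intro: lipschitz_on_continuous_on)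
  define c where "c = (1/2) *\<^sub>R (One :: 'a)"
  have "c \<in> U \<inter> {x. x \<bullet> e < pi / 2}"
    using pi_gt3 e by (auto simp: mem_U c_def)
  moreover have "open (U \<inter> {x. x \<bullet> e < pi / 2})"
    by (intro open_Int open_U open_Collect_less continuous_intros)
  ultimately obtain \<rho> where \<rho>: "0 < \<rho>" "cball c \<rho> \<subseteq> U \<inter> {x. x \<bullet> e < pi / 2}"
    by (meson open_contains_cball)
  define A where "A = {y. \<exists>x\<in>cball c \<rho>. dist (v x) (v y) = dist x y}"
  have A: "transport_set v A"
    unfolding A_def by (rule transport_set_saturation[OF cv]) simp
  then have [measurable]: "A \<in> sets borel"
    by (simp add: transport_set_def)
  have level: "y \<bullet> e < pi / 2" if "y \<in> A" for y
  proof -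
    from that obtain x where x: "x \<in> cball c \<rho>" "dist (v x) (v y) = dist x y"
      by (auto simp: A_def)
    then have "x \<in> U" "x \<bullet> e < pi / 2"
      using \<rho>(2) by auto
    then show ?thesis
      using optimal_potential_isometric_imp_same_level[OF v _ x(2)] by simp
  qed
  have pos: "0 < f y \<bullet> b" if "y \<in> A" "y \<in> U" for y
    using level[OF that(1)] that(2) by (auto simp: f_def g_def inner_add_left mem_U intro!: sin_gt_zero)
  have nonneg: "0 \<le> indicator A y * (f y \<bullet> b)" for y
    using pos[of y] by (cases "y \<in> U") (auto simp: f_def split: split_indicator)
  have int: "integrable lborel (\<lambda>y. indicator A y *\<^sub>R f y)"
    using integrable_indicator_comp[OF _ integrable_f, of "\<lambda>x. x" borel A] by simp
  have "\<mu> A \<noteq> 0"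
  proof
    assume "\<mu> A = 0"
    then have "(LINT y|lborel. indicator A y *\<^sub>R f y) \<bullet> b = 0"
      by (simp add: \<mu>_def pushforward_def)
    then have "(LINT y|lborel. indicator A y * (f y \<bullet> b)) = 0"
      using int by (simp flip: integral_inner_left)
    moreover have "integrable lborel (\<lambda>y. indicator A y * (f y \<bullet> b))"
      using integrable_inner_left[OF int, of b] by simp
    ultimately have "AE y in lborel. indicator A y * (f y \<bullet> b) = 0"
      using nonneg by (subst (asm) integral_nonneg_eq_0_iff_AE) auto
    then have "AE y in lborel. y \<in> ball c \<rho> \<longrightarrow> y \<in> {}"
    proof eventually_elim
      case (elim y)
      have "y \<in> A" "y \<in> U" if "y \<in> ball c \<rho>"
        using that \<rho>(2) by (auto simp: A_def intro!: bexI[of _ y])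
      then show ?case
        using elim pos[of y] by auto
    qed
    moreover have "c \<in> ball c \<rho>" using \<rho>(1) by simp
    ultimately show False
      using AE_lborel_open_imp_closed[OF open_ball closed_empty] by blast
  qed
  with A show ?thesis by blast
qed

end

text \<open>Adding a constant to an optimal potential keeps it optimal, so the optimal potential is
  not unique as a map. Existence is asserted, and a transport set is provided for each of
  them.\<close>

theorem theorem6:
  assumes "1 < CARD('m::finite)" and "CARD('m) \<le> CARD('n::finite)"
  shows "\<exists>\<mu> :: (real ^ 'n) set \<Rightarrow> real ^ 'm.
    \<mu> \<in> W1 \<and> vector_absolutely_continuous lborel \<mu> \<and>
    \<not> (\<exists>\<pi>. optimal_transport \<mu> \<pi> \<and>
         absolutely_continuous (total_variation \<mu>) (distr (total_variation \<pi>) borel fst)) \<and>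
    (\<exists>u. optimal_potential \<mu> u) \<and>
    (\<forall>u. optimal_potential \<mu> u \<longrightarrow> (\<exists>A. transport_set u A \<and> \<mu> A \<noteq> 0))"
proof -
  \<comment> \<open>Two distinct target coordinates span the plane of the circle; this is where the
    target dimension exceeds 1. The source direction is an arbitrary coordinate.\<close>
  obtain i j :: 'm where "i \<noteq> j"
    using assms(1) card_le_Suc0_iff_eq[of "UNIV :: 'm set"] by auto
  interpret circle_strip "axis undefined 1 :: real ^ 'n" "axis i 1 :: real ^ 'm" "axis j 1 :: real ^ 'm"
    using \<open>i \<noteq> j\<close> by unfold_locales (auto simp: axis_in_Basis_iff axis_eq_axis)
  show ?thesis
    using \<mu>_in_W1 vector_absolutely_continuous_\<mu> not_optimal_transport optimal_potential_u
      optimal_potential_transport_set by blast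
qed

end
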